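(* Let $(W,S)$ be an irreducible Coxeter system with Coxeter number $h$. Then \[\sup_{w\in W}\left|O_{\mathrm{Pop}}(w)\right|=h,\] where $\mathrm{Pop}=\mathrm{Pop}_W$ is the Coxeter pop-stack-sorting operator on $W$.
   Context: For a Coxeter system $(W,S)$, $\ell$ denotes the length function. The right weak order is defined by $x\leq_R y$ iff $\ell(x^{-1}y)=\ell(y)-\ell(x)$; it is a complete meet-semilattice, and $\bigwedge_R A$ denotes the meet of $A\subseteq W$. The right descent set of $w$ is $D_R(w)=\{s\in S:\ell(ws)<\ell(w)\}$. The Coxeter pop-stack-sorting operator is $\mathrm{Pop}_W(w)=\bigwedge_R(\{ws:s\in D_R(w)\}\cup\{w\})$. For a map $f:W\to W$, the forward orbit of $w$ is $O_f(w)=\{w,f(w),f^2(w),\ldots\}$. $W$ is irreducible if its Coxeter diagram is connected. If $W$ is finite, its Coxeter number $h$ is the order of a Coxeter element (a product of all simple generators in some order); if $W$ is infinite, $h=\infty$. *)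

theory Defs
  imports "HOL-Algebra.Algebra" "HOL-Library.Extended_Nat"
begin

section \<open>Group presentations\<close>

text \<open>
  A word over a set \<open>S\<close> of generators is a list of letters \<open>(s, e)\<close> with \<open>s \<in> S\<close>;
  \<open>(s, True)\<close> stands for \<open>s\<close> and \<open>(s, False)\<close> for the formal inverse of \<open>s\<close>.
\<close>

type_synonym 'a gword = "('a \<times> bool) list"

abbreviation gwords :: "'a set \<Rightarrow> 'a gword set"
  where "gwords S \<equiv> lists (S \<times> UNIV)"

definition gword_eval :: "('a, 'b) monoid_scheme \<Rightarrow> 'a gword \<Rightarrow> 'a"
  where "gword_eval G w =
    foldr (\<lambda>(s, e) x. (if e then s else inv\<^bsub>G\<^esub> s) \<otimes>\<^bsub>G\<^esub> x) w \<one>\<^bsub>G\<^esub>"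

definition insert_relator :: "'a set \<Rightarrow> 'a gword set \<Rightarrow> 'a gword \<Rightarrow> 'a gword \<Rightarrow> bool"
  where "insert_relator S R u v \<longleftrightarrow>
    (\<exists>a \<in> gwords S. \<exists>b \<in> gwords S. \<exists>r \<in> R \<union> {[(s, e), (s, \<not> e)] | s e. s \<in> S}.
       u = a @ b \<and> v = a @ r @ b)"

text \<open>
  \<open>G = \<langle>S | R\<rangle>\<close>: the equivalence classes of words modulo insertion and deletion of relators
  and of \<open>s s\<^sup>-\<^sup>1\<close>, \<open>s\<^sup>-\<^sup>1 s\<close> form the abstractly presented group; evaluation of words must induce
  a bijection from it onto \<open>G\<close>.
\<close>

definition presented_by :: "('a, 'b) monoid_scheme \<Rightarrow> 'a set \<Rightarrow> 'a gword set \<Rightarrow> bool"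
  where "presented_by G S R \<longleftrightarrow>
    S \<subseteq> carrier G \<and> generate G S = carrier G \<and>
    (\<forall>u \<in> gwords S. \<forall>v \<in> gwords S.
       gword_eval G u = gword_eval G v \<longleftrightarrow> equivclp (insert_relator S R) u v)"


section \<open>Coxeter systems\<close>

definition coxeter_matrix :: "'a set \<Rightarrow> ('a \<Rightarrow> 'a \<Rightarrow> enat) \<Rightarrow> bool"
  where "coxeter_matrix S m \<longleftrightarrow>
    (\<forall>s \<in> S. m s s = 1) \<and>
    (\<forall>s \<in> S. \<forall>t \<in> S. m s t = m t s) \<and>
    (\<forall>s \<in> S. \<forall>t \<in> S. s \<noteq> t \<longrightarrow> 2 \<le> m s t)"

text \<open>The relators \<open>(s t)\<^bsup>m s t\<^esup>\<close> with \<open>m s t < \<infinity>\<close>; the case \<open>s = t\<close> yields \<open>s\<^sup>2\<close>.\<close>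

definition coxeter_relators :: "'a set \<Rightarrow> ('a \<Rightarrow> 'a \<Rightarrow> enat) \<Rightarrow> 'a gword set"
  where "coxeter_relators S m =
    {concat (replicate k [(s, True), (t, True)]) | s t k. s \<in> S \<and> t \<in> S \<and> m s t = enat k}"

text \<open>The generating set is not required to be finite.\<close>

definition coxeter_system ::
    "('a, 'b) monoid_scheme \<Rightarrow> 'a set \<Rightarrow> ('a \<Rightarrow> 'a \<Rightarrow> enat) \<Rightarrow> bool"
  where "coxeter_system W S m \<longleftrightarrow>
    group W \<and> coxeter_matrix S m \<and> presented_by W S (coxeter_relators S m)"

definition coxeter_diagram :: "'a set \<Rightarrow> ('a \<Rightarrow> 'a \<Rightarrow> enat) \<Rightarrow> ('a \<times> 'a) set"
  where "coxeter_diagram S m = {(s, t). s \<in> S \<and> t \<in> S \<and> s \<noteq> t \<and> 3 \<le> m s t}"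

text \<open>The empty diagram (trivial group) counts as connected here.\<close>

definition coxeter_irreducible :: "'a set \<Rightarrow> ('a \<Rightarrow> 'a \<Rightarrow> enat) \<Rightarrow> bool"
  where "coxeter_irreducible S m \<longleftrightarrow>
    (\<forall>s \<in> S. \<forall>t \<in> S. (s, t) \<in> (coxeter_diagram S m)\<^sup>*)"

definition list_product :: "('a, 'b) monoid_scheme \<Rightarrow> 'a list \<Rightarrow> 'a"
  where "list_product W xs = foldr (\<otimes>\<^bsub>W\<^esub>) xs \<one>\<^bsub>W\<^esub>"

definition coxeter_element :: "('a, 'b) monoid_scheme \<Rightarrow> 'a set \<Rightarrow> 'a \<Rightarrow> bool"
  where "coxeter_element W S c \<longleftrightarrow>
    (\<exists>xs. distinct xs \<and> set xs = S \<and> c = list_product W xs)"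

text \<open>
  For irreducible finite \<open>W\<close> the order of a Coxeter element does not depend on the ordering of
  \<open>S\<close>. This fact is not built into the definition, which is a relation: a theorem about every
  \<open>h\<close> with \<open>is_coxeter_number W S h\<close> is a theorem about the order of every Coxeter element.
\<close>

definition is_coxeter_number :: "('a, 'b) monoid_scheme \<Rightarrow> 'a set \<Rightarrow> enat \<Rightarrow> bool"
  where "is_coxeter_number W S h \<longleftrightarrow>
    (if finite (carrier W) then \<exists>c. coxeter_element W S c \<and> h = enat (group.ord W c)
     else h = \<infinity>)"


section \<open>Weak order and pop-stack-sorting\<close>

definition coxeter_length :: "('a, 'b) monoid_scheme \<Rightarrow> 'a set \<Rightarrow> 'a \<Rightarrow> nat"
  where "coxeter_length W S w =
    (LEAST n. \<exists>xs. set xs \<subseteq> S \<and> length xs = n \<and> list_product W xs = w)"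

definition right_weak_order :: "('a, 'b) monoid_scheme \<Rightarrow> 'a set \<Rightarrow> 'a gorder"
  where "right_weak_order W S =
    \<lparr>carrier = carrier W, eq = (=),
     le = (\<lambda>x y. int (coxeter_length W S (inv\<^bsub>W\<^esub> x \<otimes>\<^bsub>W\<^esub> y)) =
                 int (coxeter_length W S y) - int (coxeter_length W S x))\<rparr>"

definition right_descents :: "('a, 'b) monoid_scheme \<Rightarrow> 'a set \<Rightarrow> 'a \<Rightarrow> 'a set"
  where "right_descents W S w =
    {s \<in> S. coxeter_length W S (w \<otimes>\<^bsub>W\<^esub> s) < coxeter_length W S w}"

definition coxeter_pop :: "('a, 'b) monoid_scheme \<Rightarrow> 'a set \<Rightarrow> 'a \<Rightarrow> 'a"
  where "coxeter_pop W S w =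
    \<Sqinter>\<^bsub>right_weak_order W S\<^esub> ({w \<otimes>\<^bsub>W\<^esub> s | s. s \<in> right_descents W S w} \<union> {w})"

definition forward_orbit :: "('a \<Rightarrow> 'a) \<Rightarrow> 'a \<Rightarrow> 'a set"
  where "forward_orbit f w = {(f ^^ n) w | n. True}"

text \<open>\<open>card\<close> is \<open>0\<close> on infinite sets, hence this extended cardinality.\<close>

definition ecard :: "'a set \<Rightarrow> enat"
  where "ecard A = (if finite A then enat (card A) else \<infinity>)"

end

(* Pop w is the minimal element of the coset of w under the parabolic subgroup generated by the
   right descents of w, so w = (Pop w) u with u longest in that (finite) subgroup.

   W finite. Then the diagram is a forest, so all Coxeter elements are conjugate, and
   S = A + B with A and B consisting of commuting generators. Playing the numbers game from a
   positive eigenvector of the (weighted) adjacency matrix, the values at A stay proportional to the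
   eigenvector, as do those at B. Hence the alternating words A B A ... with k factors are reduced up
   to some k = h at which all generators become descents simultaneously: this word represents the
   longest element, as does B A B ..., and h is the order of the product of A and B.
   Upper bound: if w is the product of a subword of q A, then Pop w is the product of a subword of q,
   by the exchange condition. After h - 1 steps from any w one reaches a product of a subword of A
   which is also the product of a subword of B, that is, the identity. Lower bound: Pop strips exactly
   the last factor from the alternating word with h - 1 factors.

   W infinite. If some finitely generated standard parabolic subgroup is infinite, lengths on it are
   unbounded, but Pop decreases them by a bounded amount. Otherwise all degrees of the diagram are at
   most 3, so it contains arbitrarily long paths s1, ..., sk, and Pop maps s1 ... sk to s1 ... s(k-1). *)

theory Submission
  imports Defs "HOL-Library.Sublist" "HOL-Analysis.Function_Topology"
begin

section \<open>Words and length\<close>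

text \<open>The numbers game stands in for root systems: whether a letter is a descent becomes the
  sign of a real number, and for alternating words all these numbers obey one scalar recursion.
  Irreducibility enters through the eigenvector: connectedness makes it positive everywhere, so all
  letters of a block change sign at the same moment. Several components would have their own
  eigenvalues and moments. The conjugacy argument is needed because \<open>is_coxeter_number\<close>
  admits every ordering of the generators. Stripping one block per step down to the empty word would
  bound orbits only by h + 1; the missing unit comes from comparing the words that start with A and
  with B. For infinite W each single orbit is still finite, since \<open>pop\<close> shortens every
  element except the identity; hence no orbit attains the supremum and arbitrarily long ones must be
  built. Both facts on the shape of the diagram come from one test on weights: constant weights
  yield leaves, weights 2, 1, 1, 1, 1 bound the degree.\<close>

definition parabolic :: "('a, 'b) monoid_scheme \<Rightarrow> 'a set \<Rightarrow> 'a set"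
  where "parabolic W J = list_product W ` lists J"

locale coxeter = group W for W :: "('a, 'b) monoid_scheme" (structure) +
  fixes S :: "'a set" and m :: "'a \<Rightarrow> 'a \<Rightarrow> enat"
  assumes cox: "coxeter_system W S m"
begin

abbreviation "lp \<equiv> list_product W"
abbreviation "len \<equiv> coxeter_length W S"
abbreviation "para \<equiv> parabolic W"

lemma S_carrier: "S \<subseteq> carrier W"
  using cox by (simp add: coxeter_system_def presented_by_def)

lemma S_closed [simp]: "s \<in> S \<Longrightarrow> s \<in> carrier W"
  using S_carrier by auto

lemma lp_Nil [simp]: "lp [] = \<one>"
  and lp_Cons [simp]: "lp (s # xs) = s \<otimes> lp xs"
  by (simp_all add: list_product_def)

lemma lp_closed [simp]: "set xs \<subseteq> carrier W \<Longrightarrow> lp xs \<in> carrier W"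
  by (induction xs) auto

lemma lp_S [simp]: "set xs \<subseteq> S \<Longrightarrow> lp xs \<in> carrier W"
  using S_carrier by (meson lp_closed order_trans)

lemma lp_append: "set xs \<subseteq> carrier W \<Longrightarrow> set ys \<subseteq> carrier W \<Longrightarrow> lp (xs @ ys) = lp xs \<otimes> lp ys"
  by (induction xs) (auto simp: m_assoc)

lemma lp_append_S: "set xs \<subseteq> S \<Longrightarrow> set ys \<subseteq> S \<Longrightarrow> lp (xs @ ys) = lp xs \<otimes> lp ys"
  using S_carrier by (meson lp_append order_trans)

lemma gword_eval_pos: "gword_eval W (map (\<lambda>s. (s, True)) xs) = lp xs"
  by (induction xs) (auto simp: gword_eval_def)

lemma matrix_refl: "s \<in> S \<Longrightarrow> m s s = 1"
  and matrix_sym: "s \<in> S \<Longrightarrow> t \<in> S \<Longrightarrow> m s t = m t s"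
  and matrix_ge2: "s \<in> S \<Longrightarrow> t \<in> S \<Longrightarrow> s \<noteq> t \<Longrightarrow> 2 \<le> m s t"
  using cox by (auto simp: coxeter_system_def coxeter_matrix_def)

lemma gword_relator_eval:
  assumes "r \<in> coxeter_relators S m" shows "gword_eval W r = \<one>"
proof -
  have r: "r \<in> gwords S"
  proof -
    have "concat (replicate k [(s, True), (t, True)]) \<in> gwords S" if "s \<in> S" "t \<in> S" for s t k
      using that by (induction k) auto
    then show ?thesis using assms unfolding coxeter_relators_def by blast
  qed
  have "insert_relator S (coxeter_relators S m) [] r"
    using assms by (force simp: insert_relator_def)
  then have "equivclp (insert_relator S (coxeter_relators S m)) [] r"
    by (rule r_into_equivclp)
  then have "gword_eval W [] = gword_eval W r"
    using cox r unfolding coxeter_system_def presented_by_def by (metis lists.Nil)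
  then show ?thesis by (simp add: gword_eval_def)
qed

lemma relator_eval:
  assumes "s \<in> S" "t \<in> S" "m s t = enat k"
  shows "lp (concat (replicate k [s, t])) = \<one>"
proof -
  have "map (\<lambda>s. (s, True)) (concat (replicate k [s, t])) = concat (replicate k [(s, True), (t, True)])"
    by (induction k) auto
  moreover have "concat (replicate k [(s, True), (t, True)]) \<in> coxeter_relators S m"
    using assms by (auto simp: coxeter_relators_def)
  ultimately show ?thesis
    using gword_relator_eval gword_eval_pos by metis
qed

lemma S_sq: "s \<in> S \<Longrightarrow> s \<otimes> s = \<one>"
  using relator_eval[of s s 1] matrix_refl by (simp add: one_enat_def)

lemma S_inv: "s \<in> S \<Longrightarrow> inv s = s"
  using S_sq by (simp add: inv_equality)

lemma S_cancel: "s \<in> S \<Longrightarrow> w \<in> carrier W \<Longrightarrow> s \<otimes> (s \<otimes> w) = w"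
  by (simp add: S_sq flip: m_assoc)

lemma S_cancel_right: "s \<in> S \<Longrightarrow> w \<in> carrier W \<Longrightarrow> (w \<otimes> s) \<otimes> s = w"
  by (simp add: S_sq m_assoc)

lemma lp_rev: "set xs \<subseteq> S \<Longrightarrow> lp (rev xs) = inv (lp xs)"
  by (induction xs) (auto simp: lp_append_S inv_mult_group S_inv)

lemma relator_pow:
  assumes "s \<in> S" "t \<in> S" shows "lp (concat (replicate k [s, t])) = (s \<otimes> t) [^] k"
proof (induction k)
  case (Suc k)
  have "(s \<otimes> t) [^] Suc k = s \<otimes> t \<otimes> (s \<otimes> t) [^] k"
    using assms by (intro nat_pow_Suc2) simp
  then show ?case using assms Suc by (simp add: m_assoc del: nat_pow_Suc)
qed simp

lemma set_relator: "s \<in> S \<Longrightarrow> t \<in> S \<Longrightarrow> set (concat (replicate k [s, t])) \<subseteq> S"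
  by (induction k) auto

text \<open>The universal property of the presentation, for invariants of words that need not come from a
  homomorphism.\<close>

lemma word_invariant:
  assumes inv: "\<And>a b s t k. set a \<subseteq> S \<Longrightarrow> set b \<subseteq> S \<Longrightarrow> s \<in> S \<Longrightarrow> t \<in> S \<Longrightarrow> m s t = enat k \<Longrightarrow>
      F (a @ concat (replicate k [s, t]) @ b) = F (a @ b)"
    and "set xs \<subseteq> S" "set ys \<subseteq> S" "lp xs = lp ys"
  shows "F xs = F ys"
proof -
  let ?p = "map (\<lambda>s. (s, True))"
  have step: "F (map fst u) = F (map fst v)"
    if uv: "insert_relator S (coxeter_relators S m) u v" for u v
  proof -
    obtain a b r where ab: "a \<in> gwords S" "b \<in> gwords S" "u = a @ b" "v = a @ r @ b"
      and r: "r \<in> coxeter_relators S m \<union> {[(s, e), (s, \<not> e)] | s e. s \<in> S}"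
      using uv unfolding insert_relator_def by blast
    \<comment> \<open>Forgetting exponents turns the cancelling pair into \<open>s s\<close>, itself
      a relator, with \<open>s = t\<close> and exponent 1.\<close>
    have "\<exists>s t k. s \<in> S \<and> t \<in> S \<and> m s t = enat k \<and> map fst r = concat (replicate k [s, t])"
    proof (cases "r \<in> coxeter_relators S m")
      case True
      then obtain s t k where "s \<in> S" "t \<in> S" "m s t = enat k"
        and rr: "r = concat (replicate k [(s, True), (t, True)])"
        by (auto simp: coxeter_relators_def)
      moreover have "map fst (concat (replicate k [(s, True), (t, True)])) = concat (replicate k [s, t])"
        by (induction k) auto
      ultimately show ?thesis by metis
    next
      case False
      then obtain s e where "s \<in> S" "r = [(s, e), (s, \<not> e)]" using r by auto
      then show ?thesis
        using matrix_refl[of s] by (intro exI[of _ s] exI[of _ 1]) (auto simp: one_enat_def)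
    qed
    moreover have "set (map fst a) \<subseteq> S" "set (map fst b) \<subseteq> S" using ab by auto
    ultimately show ?thesis using inv ab by (metis map_append)
  qed
  have "?p xs \<in> gwords S" "?p ys \<in> gwords S"
    using assms by auto
  then have "equivclp (insert_relator S (coxeter_relators S m)) (?p xs) (?p ys)"
    using cox assms gword_eval_pos unfolding coxeter_system_def presented_by_def by metis
  then have "F (map fst (?p xs)) = F (map fst (?p ys))"
    by (induction rule: equivclp_induct) (auto dest: step)
  then show ?thesis by (simp add: comp_def)
qed

text \<open>All relators have even length. This is the sign character; it will exclude that a
  generator leaves the length unchanged.\<close>

lemma length_parity:
  assumes "set xs \<subseteq> S" "set ys \<subseteq> S" "lp xs = lp ys"
  shows "even (length xs) \<longleftrightarrow> even (length ys)"
  by (rule word_invariant[where F = "\<lambda>xs. even (length xs)"])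
    (auto simp: assms length_concat sum_list_replicate)

lemma word_exists: "w \<in> carrier W \<Longrightarrow> \<exists>xs. set xs \<subseteq> S \<and> lp xs = w"
proof -
  assume "w \<in> carrier W"
  then have "w \<in> generate W S" using cox by (simp add: coxeter_system_def presented_by_def)
  then show ?thesis
  proof (induction rule: generate.induct)
    case one
    show ?case by (rule exI[of _ "[]"]) simp
  next
    case (incl h)
    then show ?case by (intro exI[of _ "[h]"]) simp
  next
    case (inv h)
    then show ?case by (intro exI[of _ "[h]"]) (simp add: S_inv)
  next
    case (eng h1 h2)
    then show ?case by (metis lp_append_S set_append Un_least)
  qed
qed

lemma carrier_para: "carrier W = para S"
proof
  show "carrier W \<subseteq> para S"
  proof
    fix w assume "w \<in> carrier W"
    then obtain xs where "set xs \<subseteq> S" "lp xs = w" using word_exists by blast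
    then show "w \<in> para S" unfolding parabolic_def by (metis image_eqI in_lists_conv_set subsetD)
  qed
qed (auto simp: parabolic_def lists_eq_set)

lemma len_le: "set xs \<subseteq> S \<Longrightarrow> len (lp xs) \<le> length xs"
  unfolding coxeter_length_def by (rule Least_le) auto

lemma reduced_word:
  assumes "w \<in> carrier W"
  obtains xs where "set xs \<subseteq> S" "lp xs = w" "length xs = len w"
proof -
  have "\<exists>n xs. set xs \<subseteq> S \<and> length xs = n \<and> lp xs = w"
    using word_exists[OF assms] by auto
  from LeastI_ex[OF this] show thesis using that by (auto simp: coxeter_length_def)
qed

lemma len_one [simp]: "len \<one> = 0"
  using len_le[of "[]"] by simp

lemma len_eq_0: "w \<in> carrier W \<Longrightarrow> len w = 0 \<longleftrightarrow> w = \<one>"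
  by (metis reduced_word length_0_conv lp_Nil len_one)

lemma len_inv [simp]: "w \<in> carrier W \<Longrightarrow> len (inv w) = len w"
proof -
  have le: "len (inv w) \<le> len w" if w: "w \<in> carrier W" for w
  proof -
    obtain xs where "set xs \<subseteq> S" "lp xs = w" "length xs = len w" by (rule reduced_word[OF w])
    then show ?thesis using len_le[of "rev xs"] lp_rev by fastforce
  qed
  show "w \<in> carrier W \<Longrightarrow> len (inv w) = len w" using le[of w] le[of "inv w"] by auto
qed

lemma len_mult: "v \<in> carrier W \<Longrightarrow> w \<in> carrier W \<Longrightarrow> len (v \<otimes> w) \<le> len v + len w"
proof -
  assume "v \<in> carrier W" "w \<in> carrier W"
  then obtain xs ys where "set xs \<subseteq> S" "lp xs = v" "length xs = len v"
    "set ys \<subseteq> S" "lp ys = w" "length ys = len w" by (metis reduced_word)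
  then show ?thesis using len_le[of "xs @ ys"] by (simp add: lp_append_S)
qed

lemma len_parity: "set xs \<subseteq> S \<Longrightarrow> even (len (lp xs)) \<longleftrightarrow> even (length xs)"
  by (metis reduced_word length_parity lp_S)

lemma len_S [simp]: "s \<in> S \<Longrightarrow> len s = 1"
  using len_le[of "[s]"] len_parity[of "[s]"] by (cases "len s") auto

lemma len_left:
  assumes s: "s \<in> S" and w: "w \<in> carrier W"
  shows "len (s \<otimes> w) = len w + 1 \<or> len w = len (s \<otimes> w) + 1"
proof -
  obtain xs where xs: "set xs \<subseteq> S" "lp xs = w" "length xs = len w" by (rule reduced_word[OF w])
  have "len (s \<otimes> w) \<noteq> len w"
    using len_parity[of "s # xs"] len_parity[of xs] xs s by auto
  moreover have "len (s \<otimes> w) \<le> len w + 1" using len_mult[of s w] s w by simp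
  moreover have "len w \<le> len (s \<otimes> w) + 1"
    using len_mult[of s "s \<otimes> w"] s w S_cancel by simp
  ultimately show ?thesis by linarith
qed

lemma len_right_inv: "s \<in> S \<Longrightarrow> w \<in> carrier W \<Longrightarrow> len (w \<otimes> s) = len (s \<otimes> inv w)"
  by (metis S_closed S_inv inv_closed inv_mult_group len_inv m_closed)

lemma len_right:
  "s \<in> S \<Longrightarrow> w \<in> carrier W \<Longrightarrow> len (w \<otimes> s) = len w + 1 \<or> len w = len (w \<otimes> s) + 1"
  using len_left[of s "inv w"] by (simp add: len_right_inv)

section \<open>The exchange condition\<close>

text \<open>\<open>reflection_odd xs r\<close>: the conjugate of the \<open>i\<close>th letter of \<open>xs\<close> by the product of the
  preceding ones equals \<open>r\<close> for an odd number of \<open>i\<close>.\<close>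

fun reflection_odd :: "'a list \<Rightarrow> 'a \<Rightarrow> bool" where
  "reflection_odd [] r = False"
| "reflection_odd (s # xs) r = ((r = s) \<noteq> reflection_odd xs (s \<otimes> r \<otimes> s))"

text \<open>Cocycle rule: the conjugates coming from \<open>b\<close> carry the extra factor
  \<open>lp a\<close>, which can be moved over to \<open>r\<close>.\<close>

lemma reflection_odd_append:
  "set a \<subseteq> S \<Longrightarrow> set b \<subseteq> S \<Longrightarrow> r \<in> carrier W \<Longrightarrow>
   reflection_odd (a @ b) r \<longleftrightarrow> reflection_odd a r \<noteq> reflection_odd b (inv (lp a) \<otimes> r \<otimes> lp a)"
proof (induction a arbitrary: r)
  case (Cons s a)
  have "inv (lp a) \<otimes> (s \<otimes> r \<otimes> s) \<otimes> lp a = inv (lp (s # a)) \<otimes> r \<otimes> lp (s # a)"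
    using Cons.prems by (simp add: inv_mult_group S_inv m_assoc)
  moreover have "reflection_odd (a @ b) (s \<otimes> r \<otimes> s) \<longleftrightarrow> reflection_odd a (s \<otimes> r \<otimes> s) \<noteq>
      reflection_odd b (inv (lp a) \<otimes> (s \<otimes> r \<otimes> s) \<otimes> lp a)"
    using Cons.prems by (intro Cons.IH) auto
  ultimately show ?case by (simp only: append_Cons reflection_odd.simps) blast
qed simp

lemma conj_eq_iff:
  assumes p: "p \<in> carrier W" and r: "r \<in> carrier W" and g: "g \<in> carrier W"
  shows "inv p \<otimes> r \<otimes> p = g \<longleftrightarrow> r = p \<otimes> g \<otimes> inv p"
proof -
  have c: "p \<otimes> (inv p \<otimes> x) = x" "inv p \<otimes> (p \<otimes> x) = x" if "x \<in> carrier W" for x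
    using p that by (simp_all flip: m_assoc)
  have "p \<otimes> (inv p \<otimes> r \<otimes> p) \<otimes> inv p = r" "inv p \<otimes> (p \<otimes> g \<otimes> inv p) \<otimes> p = g"
    using p r g by (simp_all add: m_assoc c)
  then show ?thesis by metis
qed

text \<open>The involution \<open>s\<close> inverts the rotation
  \<open>s \<otimes> t\<close>.\<close>

lemma dihedral_pow_conj:
  assumes s: "s \<in> S" and t: "t \<in> S"
  shows "s \<otimes> inv ((s \<otimes> t) [^] (j::nat)) = (s \<otimes> t) [^] j \<otimes> s"
proof (induction j)
  case (Suc j)
  let ?p = "(s \<otimes> t) [^] j"
  have "s \<otimes> inv ((s \<otimes> t) [^] Suc j) = s \<otimes> (t \<otimes> (s \<otimes> inv ?p))"
    using s t by (simp add: inv_mult_group S_inv m_assoc)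
  also have "\<dots> = s \<otimes> t \<otimes> ?p \<otimes> s"
    using s t Suc by (simp add: m_assoc)
  also have "s \<otimes> t \<otimes> ?p = (s \<otimes> t) [^] Suc j"
    using s t by (intro nat_pow_Suc2[symmetric]) simp
  finally show ?case .
qed (use s in simp)

text \<open>The letter at position \<open>i\<close>, counted from 0, contributes the dihedral
  reflection \<open>(s \<otimes> t) [^] i \<otimes> s\<close>.\<close>

lemma reflection_odd_relator:
  assumes s: "s \<in> S" and t: "t \<in> S" and r: "r \<in> carrier W"
  shows "reflection_odd (concat (replicate j [s, t])) r \<longleftrightarrow>
    odd (card {i. i < 2 * j \<and> r = (s \<otimes> t) [^] i \<otimes> s})"
proof (induction j)
  case (Suc j)
  let ?p = "(s \<otimes> t) [^] j" and ?w = "concat (replicate j [s, t])"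
  have p: "?p \<in> carrier W" using s t by simp
  have conj: "inv ?p \<otimes> r \<otimes> ?p = g \<longleftrightarrow> r = ?p \<otimes> g \<otimes> inv ?p" if g: "g \<in> carrier W" for g
    using conj_eq_iff[OF p r g] .
  have a1: "?p \<otimes> s \<otimes> inv ?p = (s \<otimes> t) [^] (2 * j) \<otimes> s"
    using s t p dihedral_pow_conj[OF s t, of j]
    by (simp add: m_assoc mult_2 flip: nat_pow_mult)
  have "?p \<otimes> (s \<otimes> t \<otimes> s) \<otimes> inv ?p = (?p \<otimes> (s \<otimes> t)) \<otimes> (s \<otimes> inv ?p)"
    using s t p by (simp add: m_assoc)
  also have "\<dots> = ((s \<otimes> t) [^] Suc j) \<otimes> (?p \<otimes> s)"
    using s t p dihedral_pow_conj[OF s t, of j] by simp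
  also have "\<dots> = (s \<otimes> t) [^] (Suc j + j) \<otimes> s"
    using s t p by (subst nat_pow_mult[symmetric]) (auto simp: m_assoc)
  finally have a2: "?p \<otimes> (s \<otimes> t \<otimes> s) \<otimes> inv ?p = (s \<otimes> t) [^] (Suc (2 * j)) \<otimes> s"
    by (simp add: mult_2)
  have "concat (replicate (Suc j) [s, t]) = ?w @ [s, t]"
    by (induction j) auto
  moreover have "set ?w \<subseteq> S" by (rule set_relator[OF s t])
  ultimately have "reflection_odd (concat (replicate (Suc j) [s, t])) r \<longleftrightarrow>
     reflection_odd ?w r \<noteq> reflection_odd [s, t] (inv ?p \<otimes> r \<otimes> ?p)"
    using reflection_odd_append[of ?w "[s, t]" r] s t r relator_pow[OF s t, of j] by simp
  also have "reflection_odd [s, t] (inv ?p \<otimes> r \<otimes> ?p) \<longleftrightarrow>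
     (r = (s \<otimes> t) [^] (2 * j) \<otimes> s) \<noteq> (r = (s \<otimes> t) [^] (Suc (2 * j)) \<otimes> s)"
  proof -
    let ?g = "inv ?p \<otimes> r \<otimes> ?p"
    have g: "?g \<in> carrier W" using p r by simp
    have "s \<otimes> (s \<otimes> ?g \<otimes> s) \<otimes> s = ?g" "s \<otimes> (s \<otimes> t \<otimes> s) \<otimes> s = t"
      using s t g by (simp_all add: S_cancel S_sq m_assoc del: inv_mult_group)
    then have "t = s \<otimes> ?g \<otimes> s \<longleftrightarrow> ?g = s \<otimes> t \<otimes> s" by metis
    then have "s \<otimes> ?g \<otimes> s = t \<longleftrightarrow> ?g = s \<otimes> t \<otimes> s" by metis
    then show ?thesis
      using conj[of s] conj[of "s \<otimes> t \<otimes> s"] a1 a2 s t by simp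
  qed
  also have "reflection_odd ?w r \<longleftrightarrow> odd (card {i. i < 2 * j \<and> r = (s \<otimes> t) [^] i \<otimes> s})"
    by (rule Suc)
  also have "(odd (card {i. i < 2 * j \<and> r = (s \<otimes> t) [^] i \<otimes> s}) \<noteq>
     ((r = (s \<otimes> t) [^] (2 * j) \<otimes> s) \<noteq> (r = (s \<otimes> t) [^] (Suc (2 * j)) \<otimes> s))) \<longleftrightarrow>
     odd (card {i. i < 2 * Suc j \<and> r = (s \<otimes> t) [^] i \<otimes> s})"
  proof -
    let ?Q = "\<lambda>i::nat. r = (s \<otimes> t) [^] i \<otimes> s"
    have step: "card {i. i < Suc n \<and> ?Q i} = card {i. i < n \<and> ?Q i} + (if ?Q n then 1 else 0)" for n
    proof -
      have "{i. i < Suc n \<and> ?Q i} = {i. i < n \<and> ?Q i} \<union> (if ?Q n then {n} else {})"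
        by (auto simp: less_Suc_eq)
      then show ?thesis by (auto simp: card_insert_if)
    qed
    show ?thesis using step[of "2 * j"] step[of "Suc (2 * j)"] by auto
  qed
  finally show ?case .
qed simp

text \<open>These reflections repeat with period \<open>k\<close>, so among \<open>2 * k\<close>
  positions each is met an even number of times.\<close>

lemma reflection_odd_relator_False:
  assumes "s \<in> S" "t \<in> S" "r \<in> carrier W" and k: "(s \<otimes> t) [^] k = \<one>"
  shows "\<not> reflection_odd (concat (replicate k [s, t])) r"
proof -
  let ?Q = "\<lambda>i::nat. r = (s \<otimes> t) [^] i \<otimes> s"
  have per: "?Q (i + k) \<longleftrightarrow> ?Q i" for i
    using assms by (simp flip: nat_pow_mult)
  have "{i. i < 2 * k \<and> ?Q i} = {i. i < k \<and> ?Q i} \<union> (\<lambda>i. i + k) ` {i. i < k \<and> ?Q i}"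
  proof (intro equalityI subsetI)
    fix i assume i: "i \<in> {i. i < 2 * k \<and> ?Q i}"
    show "i \<in> {i. i < k \<and> ?Q i} \<union> (\<lambda>i. i + k) ` {i. i < k \<and> ?Q i}"
    proof (cases "i < k")
      case False
      then have "i - k < k" "?Q (i - k)" "i = (i - k) + k" using i per[of "i - k"] by auto
      then show ?thesis by blast
    qed (use i in auto)
  qed (use per in auto)
  also have "card \<dots> = card {i. i < k \<and> ?Q i} + card ((\<lambda>i. i + k) ` {i. i < k \<and> ?Q i})"
    by (rule card_Un_disjoint) auto
  also have "\<dots> = 2 * card {i. i < k \<and> ?Q i}"
    by (subst card_image) (auto simp: inj_on_def)
  finally show ?thesis using reflection_odd_relator assms by simp
qed

lemma reflection_odd_cong:
  assumes "set xs \<subseteq> S" "set ys \<subseteq> S" "lp xs = lp ys" "r \<in> carrier W"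
  shows "reflection_odd xs r \<longleftrightarrow> reflection_odd ys r"
proof -
  \<comment> \<open>The invariant is a function of \<open>r\<close>; the cocycle rule is available
    only on the carrier, so the function is cut off outside it.\<close>
  let ?F = "\<lambda>xs. \<lambda>r. r \<in> carrier W \<and> reflection_odd xs r"
  have "?F xs = ?F ys"
  proof (rule word_invariant[OF _ assms(1-3)], rule ext, rule conj_cong[OF refl])
    fix a b s t k r
    assume *: "set a \<subseteq> S" "set b \<subseteq> S" "s \<in> S" "t \<in> S" "m s t = enat k" "r \<in> carrier W"
    let ?w = "concat (replicate k [s, t])" and ?q = "inv (lp a) \<otimes> r \<otimes> lp a"
    have w: "set ?w \<subseteq> S" "lp ?w = \<one>"
      using * relator_eval set_relator by blast+
    have pw: "(s \<otimes> t) [^] k = \<one>" using relator_pow w * by metis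
    have q: "?q \<in> carrier W" using * by simp
    then have "reflection_odd (?w @ b) ?q \<longleftrightarrow> reflection_odd b ?q"
      using * w pw reflection_odd_append[of ?w b ?q] reflection_odd_relator_False[of s t ?q k] by simp
    then show "reflection_odd (a @ ?w @ b) r \<longleftrightarrow> reflection_odd (a @ b) r"
      using * w reflection_odd_append[of a "?w @ b" r] reflection_odd_append[of a b r] by simp
  qed
  then show ?thesis using assms by metis
qed

definition delete_nth :: "nat \<Rightarrow> 'c list \<Rightarrow> 'c list"
  where "delete_nth i xs = take i xs @ drop (Suc i) xs"

lemma subseq_set: "subseq xs ys \<Longrightarrow> set xs \<subseteq> set ys"
  by (induction rule: list_emb.induct) auto

lemma subseq_delete_nth: "subseq (delete_nth i xs) xs"
proof -
  have "subseq (drop (Suc i) xs) (drop i xs)"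
  proof (cases "i < length xs")
    case True
    then show ?thesis by (simp flip: Cons_nth_drop_Suc add: list_emb_Cons)
  qed simp
  then have "subseq (take i xs @ drop (Suc i) xs) (take i xs @ drop i xs)"
    unfolding subseq_append' .
  then show ?thesis by (simp add: delete_nth_def)
qed

lemma set_delete_nth: "set (delete_nth i xs) \<subseteq> set xs"
  unfolding delete_nth_def using set_take_subset set_drop_subset by fastforce

lemma length_delete_nth: "i < length xs \<Longrightarrow> length (delete_nth i xs) = length xs - 1"
  by (simp add: delete_nth_def)

lemma reflection_odd_delete:
  "set ys \<subseteq> S \<Longrightarrow> r \<in> carrier W \<Longrightarrow> reflection_odd ys r \<Longrightarrow>
   \<exists>i<length ys. r \<otimes> lp ys = lp (delete_nth i ys)"
proof (induction ys arbitrary: r)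
  case (Cons s ys)
  show ?case
  proof (cases "r = s")
    case True
    then show ?thesis using Cons.prems by (intro exI[of _ 0]) (simp add: S_cancel delete_nth_def)
  next
    case False
    then have "reflection_odd ys (s \<otimes> r \<otimes> s)" using Cons.prems by simp
    then obtain i where i: "i < length ys" "s \<otimes> r \<otimes> s \<otimes> lp ys = lp (delete_nth i ys)"
      using Cons.IH[of "s \<otimes> r \<otimes> s"] Cons.prems by auto
    have "r \<otimes> lp (s # ys) = s \<otimes> (s \<otimes> r \<otimes> s \<otimes> lp ys)"
      using Cons.prems by (simp add: m_assoc S_cancel)
    then show ?thesis using i by (intro exI[of _ "Suc i"]) (simp add: delete_nth_def)
  qed
qed simp

text \<open>Let \<open>ys\<close> be reduced for \<open>s \<otimes> lp xs\<close>. If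
  \<open>ys\<close> met \<open>s\<close> an odd number of times, deleting a letter of
  \<open>ys\<close> would spell the longer element \<open>lp xs\<close>. So \<open>s # ys\<close>
  meets \<open>s\<close> an odd number of times; this parity depends on the group element only,
  hence \<open>xs\<close>, reduced or not, has a letter to delete.\<close>

lemma exchange_left:
  assumes xs: "set xs \<subseteq> S" and s: "s \<in> S" and l: "len (s \<otimes> lp xs) < len (lp xs)"
  shows "\<exists>i<length xs. s \<otimes> lp xs = lp (delete_nth i xs)"
proof (rule reflection_odd_delete)
  have c: "s \<otimes> lp xs \<in> carrier W" using xs s by simp
  obtain ys where ys: "set ys \<subseteq> S" "lp ys = s \<otimes> lp xs" "length ys = len (s \<otimes> lp xs)"
    by (rule reduced_word[OF c])
  have e: "lp (s # ys) = lp xs" using ys xs s by (simp add: S_cancel)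
  have "\<not> reflection_odd ys s"
  proof
    assume "reflection_odd ys s"
    then obtain i where i: "i < length ys" "s \<otimes> lp ys = lp (delete_nth i ys)"
      using reflection_odd_delete ys s by (meson S_closed)
    have "len (lp xs) \<le> length (delete_nth i ys)"
      using i e len_le[of "delete_nth i ys"] set_delete_nth[of i ys] ys by fastforce
    then show False using i ys l by (simp add: length_delete_nth)
  qed
  then have "reflection_odd (s # ys) s" using s by (simp add: S_sq)
  then show "reflection_odd xs s"
    using reflection_odd_cong[of "s # ys" xs s] e ys xs s by simp
qed (use assms in auto)

lemma rev_delete_nth: "i < length xs \<Longrightarrow> rev (delete_nth i xs) = delete_nth (length xs - Suc i) (rev xs)"
  by (simp add: delete_nth_def rev_take rev_drop Suc_diff_Suc)

lemma exchange_right: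
  assumes xs: "set xs \<subseteq> S" and s: "s \<in> S" and l: "len (lp xs \<otimes> s) < len (lp xs)"
  shows "\<exists>i<length xs. lp xs \<otimes> s = lp (delete_nth i xs)"
proof -
  have r: "set (rev xs) \<subseteq> S" "lp (rev xs) = inv (lp xs)" using xs by (auto simp: lp_rev)
  obtain i where i: "i < length xs" "s \<otimes> lp (rev xs) = lp (delete_nth i (rev xs))"
    using exchange_left[OF r(1) s] l r xs s by (auto simp: len_right_inv)
  let ?j = "length xs - Suc i"
  have "rev (delete_nth ?j xs) = delete_nth i (rev xs)"
    using rev_delete_nth[of ?j xs] i by (simp add: Suc_diff_Suc)
  moreover have "set (delete_nth ?j xs) \<subseteq> S" using set_delete_nth[of ?j xs] xs by auto
  ultimately have "inv (lp xs \<otimes> s) = inv (lp (delete_nth ?j xs))"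
    using i r xs s lp_rev[of "delete_nth ?j xs"] by (simp add: inv_mult_group S_inv)
  moreover have "lp (delete_nth ?j xs) \<in> carrier W"
    using \<open>set (delete_nth ?j xs) \<subseteq> S\<close> by simp
  ultimately have "lp xs \<otimes> s = lp (delete_nth ?j xs)"
    using xs s by (metis S_closed inv_inv lp_S m_closed)
  then show ?thesis using i by (intro exI[of _ ?j]) auto
qed

text \<open>Prepending a letter either keeps the chosen subword reduced or, by exchange, deletes one
  of its letters. Thus reduced words can be found without using new letters.\<close>

lemma reduced_subseq:
  "set xs \<subseteq> S \<Longrightarrow> \<exists>ys. subseq ys xs \<and> lp ys = lp xs \<and> length ys = len (lp xs)"
proof (induction xs)
  case (Cons s xs)
  then obtain ys where ys: "subseq ys xs" "lp ys = lp xs" "length ys = len (lp xs)" by auto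
  have sub: "set ys \<subseteq> S" using ys(1) Cons.prems subseq_set by fastforce
  have s: "s \<in> S" and w: "lp xs \<in> carrier W" using Cons.prems by auto
  consider "len (s \<otimes> lp xs) = len (lp xs) + 1" | "len (lp xs) = len (s \<otimes> lp xs) + 1"
    using len_left[OF s w] by blast
  then show ?case
  proof cases
    case 1
    then show ?thesis using ys by (intro exI[of _ "s # ys"]) auto
  next
    case 2
    then obtain i where "i < length ys" "s \<otimes> lp ys = lp (delete_nth i ys)"
      using exchange_left[OF sub s] ys by auto
    moreover have "subseq (delete_nth i ys) (s # xs)"
      using subseq_delete_nth ys(1) by (meson list_emb_Cons subseq_order.order_trans)
    ultimately show ?thesis using 2 ys
      by (intro exI[of _ "delete_nth i ys"]) (auto simp: length_delete_nth)
  qed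
qed auto

section \<open>Parabolic subgroups\<close>

lemma para_iff: "w \<in> para J \<longleftrightarrow> (\<exists>xs. set xs \<subseteq> J \<and> lp xs = w)"
  by (auto simp: parabolic_def lists_eq_set)

lemma lp_para: "set xs \<subseteq> J \<Longrightarrow> lp xs \<in> para J"
  by (auto simp: para_iff)

lemma para_closed: "J \<subseteq> S \<Longrightarrow> w \<in> para J \<Longrightarrow> w \<in> carrier W"
  by (auto simp: para_iff)

lemma para_reduced:
  assumes "J \<subseteq> S" "w \<in> para J"
  obtains xs where "set xs \<subseteq> J" "lp xs = w" "length xs = len w"
proof -
  obtain ys where ys: "set ys \<subseteq> J" "lp ys = w" using assms by (auto simp: para_iff)
  then obtain xs where "subseq xs ys" "lp xs = lp ys" "length xs = len (lp ys)"
    using reduced_subseq[of ys] assms by auto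
  then show thesis using that[of xs] ys subseq_set[of xs ys] by auto
qed

lemma para_one [simp]: "\<one> \<in> para J"
  using lp_para[of "[]" J] by simp

lemma para_gen: "J \<subseteq> S \<Longrightarrow> s \<in> J \<Longrightarrow> s \<in> para J"
  using lp_para[of "[s]" J] by auto

lemma para_mult: "J \<subseteq> S \<Longrightarrow> v \<in> para J \<Longrightarrow> w \<in> para J \<Longrightarrow> v \<otimes> w \<in> para J"
proof -
  assume "J \<subseteq> S" "v \<in> para J" "w \<in> para J"
  then obtain xs ys where "set xs \<subseteq> J" "lp xs = v" "set ys \<subseteq> J" "lp ys = w"
    by (auto simp: para_iff)
  then show ?thesis using \<open>J \<subseteq> S\<close> lp_para[of "xs @ ys" J] lp_append_S[of xs ys] by auto
qed

lemma para_inv: "J \<subseteq> S \<Longrightarrow> w \<in> para J \<Longrightarrow> inv w \<in> para J"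
proof -
  assume "J \<subseteq> S" "w \<in> para J"
  then obtain xs where "set xs \<subseteq> J" "lp xs = w" by (auto simp: para_iff)
  then show ?thesis using \<open>J \<subseteq> S\<close> lp_para[of "rev xs" J] lp_rev[of xs] by auto
qed

lemma para_mono: "I \<subseteq> J \<Longrightarrow> para I \<subseteq> para J"
  unfolding parabolic_def by (intro image_mono lists_mono)

lemma S_in_para:
  assumes "J \<subseteq> S" "s \<in> S" "s \<in> para J" shows "s \<in> J"
proof -
  obtain xs where xs: "set xs \<subseteq> J" "lp xs = s" "length xs = len s"
    by (rule para_reduced[OF assms(1,3)])
  then obtain t where "xs = [t]" using assms(2) by (auto simp: length_Suc_conv)
  then show ?thesis using xs assms by auto
qed

text \<open>Exchange puts \<open>w \<otimes> s\<close> into the subgroup, hence also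
  \<open>s = inv w \<otimes> (w \<otimes> s)\<close>.\<close>

lemma para_descent:
  assumes "J \<subseteq> S" "w \<in> para J" "s \<in> S" "len (w \<otimes> s) < len w"
  shows "s \<in> J"
proof -
  obtain xs where xs: "set xs \<subseteq> J" "lp xs = w" using assms by (auto simp: para_iff)
  then obtain i where i: "w \<otimes> s = lp (delete_nth i xs)"
    using exchange_right[of xs s] assms by auto
  then have "w \<otimes> s \<in> para J" using set_delete_nth[of i xs] xs by (auto intro: lp_para)
  then have "inv w \<otimes> (w \<otimes> s) \<in> para J" using assms para_mult[OF assms(1) para_inv[OF assms(1,2)]] by simp
  moreover have "inv w \<otimes> (w \<otimes> s) = s"
    using assms para_closed[OF assms(1,2)] by (simp flip: m_assoc)
  ultimately show ?thesis using S_in_para assms by metis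
qed

lemma right_descent_exists:
  assumes "J \<subseteq> S" "w \<in> para J" "w \<noteq> \<one>"
  shows "\<exists>s\<in>J. len (w \<otimes> s) < len w"
proof -
  obtain xs where xs: "set xs \<subseteq> J" "lp xs = w" "length xs = len w"
    by (rule para_reduced[OF assms(1,2)])
  then obtain ys s where ys: "xs = ys @ [s]" using assms by (metis lp_Nil rev_exhaust)
  have "set ys \<subseteq> S" "s \<in> S" using xs ys assms by auto
  then have "w \<otimes> s = lp ys" using xs ys by (auto simp: lp_append_S S_cancel_right)
  then have "len (w \<otimes> s) \<le> length ys" using len_le[of ys] \<open>set ys \<subseteq> S\<close> by simp
  also have "\<dots> < len w" using xs(3) ys by simp
  finally have "len (w \<otimes> s) < len w" .
  then show ?thesis using xs ys by auto
qed

text \<open>Append a reduced word of \<open>v\<close> to one of \<open>x\<close> letter by letter.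
  If a letter shortened the product, exchange would delete a letter of \<open>x\<close>, leaving a
  shorter element of the coset, or a letter of the word of \<open>v\<close>, which is
  reduced.\<close>

lemma coset_minimum_additive:
  assumes J: "J \<subseteq> S" and x: "x \<in> carrier W"
    and min: "\<And>v. v \<in> para J \<Longrightarrow> len x \<le> len (x \<otimes> v)" and v: "v \<in> para J"
  shows "len (x \<otimes> v) = len x + len v"
proof -
  obtain vs where "set vs \<subseteq> J" "lp vs = v" "length vs = len v" by (rule para_reduced[OF J v])
  moreover have "set vs \<subseteq> J \<Longrightarrow> length vs = len (lp vs) \<Longrightarrow>
      len (x \<otimes> lp vs) = len x + length vs" for vs
  proof (induction vs rule: rev_induct)
    case (snoc s vs)
    let ?v = "lp vs"
    have vJ: "set vs \<subseteq> J" "s \<in> J" and sS: "s \<in> S" and vS: "set vs \<subseteq> S"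
      using snoc.prems J by auto
    have vs: "?v \<in> carrier W" "lp (vs @ [s]) = ?v \<otimes> s"
      using vS sS by (auto simp: lp_append_S)
    have red: "length vs = len ?v"
      using snoc.prems(2) len_le[OF vS] len_right[OF sS vs(1)] vs(2) by auto
    then have IH: "len (x \<otimes> ?v) = len x + length vs" using snoc.IH vJ by blast
    have "\<not> len (x \<otimes> ?v \<otimes> s) < len (x \<otimes> ?v)"
    proof
      assume lt: "len (x \<otimes> ?v \<otimes> s) < len (x \<otimes> ?v)"
      obtain xs where xs: "set xs \<subseteq> S" "lp xs = x" "length xs = len x" by (rule reduced_word[OF x])
      have e: "lp (xs @ vs) = x \<otimes> ?v" "set (xs @ vs) \<subseteq> S" using xs vS by (auto simp: lp_append_S)
      then obtain i where i: "i < length xs + length vs" "x \<otimes> ?v \<otimes> s = lp (delete_nth i (xs @ vs))"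
        using exchange_right[of "xs @ vs" s] lt sS by auto
      show False
      proof (cases "i < length xs")
        case True
        have d: "delete_nth i (xs @ vs) = delete_nth i xs @ vs" "set (delete_nth i xs) \<subseteq> S"
          using True set_delete_nth[of i xs] xs by (auto simp: delete_nth_def)
        let ?y = "lp (delete_nth i xs)"
        have "?y = (?y \<otimes> ?v) \<otimes> inv ?v" using d vs by (simp add: m_assoc)
        also have "?y \<otimes> ?v = x \<otimes> ?v \<otimes> s" using i d vS by (simp add: lp_append_S)
        finally have "?y = x \<otimes> (?v \<otimes> s \<otimes> inv ?v)" using x vs sS by (simp add: m_assoc)
        moreover have "?v \<otimes> s \<otimes> inv ?v \<in> para J"
          using J vJ by (intro para_mult para_inv para_gen lp_para)
        ultimately have "len x \<le> len ?y" using min by simp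
        then show False using len_le[OF d(2)] True xs by (simp add: length_delete_nth)
      next
        case False
        let ?j = "i - length xs"
        have d: "delete_nth i (xs @ vs) = xs @ delete_nth ?j vs" "set (delete_nth ?j vs) \<subseteq> S"
          using False set_delete_nth[of ?j vs] vS by (auto simp: delete_nth_def Suc_diff_le)
        have "x \<otimes> (?v \<otimes> s) = x \<otimes> lp (delete_nth ?j vs)"
          using i d xs vs sS x by (simp add: lp_append_S m_assoc)
        then have "?v \<otimes> s = lp (delete_nth ?j vs)" using x vs sS d by simp
        then have "len (lp (vs @ [s])) \<le> length vs - 1"
          using len_le[OF d(2)] False i vs by (simp add: length_delete_nth)
        then show False using snoc.prems by simp
      qed
    qed
    then have "len (x \<otimes> ?v \<otimes> s) = len (x \<otimes> ?v) + 1"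
      using len_right[OF sS, of "x \<otimes> ?v"] x vs by auto
    then show ?case using IH vs x sS by (simp add: m_assoc)
  qed (use x in simp)
  ultimately show ?thesis by auto
qed

lemma parabolic_decomposition:
  assumes J: "J \<subseteq> S" and w: "w \<in> carrier W"
  obtains x u where "x \<in> carrier W" "u \<in> para J" "w = x \<otimes> u"
    "\<forall>v\<in>para J. len (x \<otimes> v) = len x + len v"
proof -
  obtain v0 where v0: "v0 \<in> para J" and min: "\<And>v. v \<in> para J \<Longrightarrow> len (w \<otimes> v0) \<le> len (w \<otimes> v)"
    using ex_has_least_nat[of "\<lambda>v. v \<in> para J" \<one> "\<lambda>v. len (w \<otimes> v)"] para_one by blast
  let ?x = "w \<otimes> v0"
  have v0c: "v0 \<in> carrier W" using para_closed J v0 by blast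
  have "len ?x \<le> len (?x \<otimes> v)" if "v \<in> para J" for v
    using min[of "v0 \<otimes> v"] para_mult[OF J v0 that] para_closed[OF J that] w v0c
    by (simp add: m_assoc)
  moreover have "w = ?x \<otimes> inv v0" using w v0c by (simp add: m_assoc)
  ultimately show thesis
    using that[of ?x "inv v0"] coset_minimum_additive[OF J, of ?x] para_inv[OF J v0] w v0c by simp
qed

text \<open>Local test for minimality: write \<open>x = y \<otimes> u\<close> with \<open>y\<close>
  minimal in the coset; a descent of \<open>u\<close> in \<open>J\<close> would be a descent of
  \<open>x\<close>, so \<open>u\<close> is trivial.\<close>

lemma minimal_additive:
  assumes J: "J \<subseteq> S" and x: "x \<in> carrier W" and asc: "\<And>s. s \<in> J \<Longrightarrow> len x < len (x \<otimes> s)"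
    and v: "v \<in> para J"
  shows "len (x \<otimes> v) = len x + len v"
proof -
  obtain y u where y: "y \<in> carrier W" "u \<in> para J" "x = y \<otimes> u"
    "\<forall>v\<in>para J. len (y \<otimes> v) = len y + len v"
    by (rule parabolic_decomposition[OF J x])
  have uc: "u \<in> carrier W" using para_closed J y by blast
  have "u = \<one>"
  proof (rule ccontr)
    assume "u \<noteq> \<one>"
    then obtain s where s: "s \<in> J" "len (u \<otimes> s) < len u" using right_descent_exists J y by blast
    have "len (x \<otimes> s) = len y + len (u \<otimes> s)"
      using bspec[OF y(4), of "u \<otimes> s"] y uc s J para_mult[OF J y(2) para_gen[OF J s(1)]]
      by (simp add: m_assoc subset_iff)
    then show False using asc[OF s(1)] y s by simp
  qed
  then show ?thesis using y v by simp
qed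

section \<open>The numbers game\<close>

text \<open>\<open>fire\<close> is the contragredient of the geometric representation, in the coordinates given by
  the simple roots: \<open>f r\<close> is the value of the linear functional \<open>f\<close> at the root of \<open>r\<close>, and
  \<open>game_coeff s r\<close> is \<open>-2\<close> times the bilinear form of the two roots.\<close>

definition game_coeff :: "'a \<Rightarrow> 'a \<Rightarrow> real" where
  "game_coeff s t = (if s = t then - 2 else
     case m s t of enat k \<Rightarrow> 2 * cos (pi / real k) | \<infinity> \<Rightarrow> 2)"

definition fire :: "'a \<Rightarrow> ('a \<Rightarrow> real) \<Rightarrow> 'a \<Rightarrow> real" where
  "fire s f = (\<lambda>r. f r + game_coeff s r * f s)"

definition play :: "'a list \<Rightarrow> ('a \<Rightarrow> real) \<Rightarrow> 'a \<Rightarrow> real" where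
  "play xs f = foldr fire xs f"

lemma play_Nil [simp]: "play [] f = f"
  and play_Cons [simp]: "play (s # xs) f = fire s (play xs f)"
  and play_append: "play (xs @ ys) f = play xs (play ys f)"
  by (simp_all add: play_def)

lemma game_coeff_same [simp]: "game_coeff s s = - 2"
  by (simp add: game_coeff_def)

lemma fire_same [simp]: "fire s f s = - f s"
  by (simp add: fire_def)

lemma fire_fire [simp]: "fire s (fire s f) = f"
  by (simp add: fire_def fun_eq_iff)

lemma game_coeff_sym: "s \<in> S \<Longrightarrow> t \<in> S \<Longrightarrow> game_coeff s t = game_coeff t s"
  by (simp add: game_coeff_def matrix_sym)

text \<open>The Chebyshev polynomial of the second kind of degree \<open>n - 1\<close> at
  \<open>cos (pi / k)\<close>, written with sines; for an infinite bond, its limit as the angle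
  tends to 0.\<close>

definition cheb :: "'a \<Rightarrow> 'a \<Rightarrow> nat \<Rightarrow> real" where
  "cheb s t n = (case m s t of enat k \<Rightarrow> sin (real n * pi / real k) / sin (pi / real k) | \<infinity> \<Rightarrow> real n)"

context
  fixes s t assumes s: "s \<in> S" and t: "t \<in> S" and st: "s \<noteq> t"
begin

lemma matrix_finite_ge2: "m s t = enat k \<Longrightarrow> k \<ge> 2"
  using matrix_ge2[OF s t st] by (metis enat_ord_simps(1) numeral_eq_enat)

lemma sin_pos: "m s t = enat k \<Longrightarrow> sin (pi / real k) > 0"
  using matrix_finite_ge2[of k] by (intro sin_gt_zero) (auto simp: field_simps)

lemma cheb_0: "cheb s t 0 = 0"
  by (simp add: cheb_def split: enat.split)

lemma cheb_1: "cheb s t (Suc 0) = 1"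
  using sin_pos by (auto simp: cheb_def split: enat.split)

lemma cheb_rec: "cheb s t (Suc (Suc n)) = game_coeff s t * cheb s t (Suc n) - cheb s t n"
proof (cases "m s t")
  case (enat k)
  let ?h = "pi / real k" and ?a = "real (Suc n) * pi / real k"
  have "real (Suc (Suc n)) * pi / real k = ?a + ?h" "real n * pi / real k = ?a - ?h"
    by (simp_all add: field_simps add_divide_distrib)
  then have "sin (real (Suc (Suc n)) * pi / real k) + sin (real n * pi / real k) = 2 * cos ?h * sin ?a"
    by (simp add: sin_add sin_diff)
  then show ?thesis using st sin_pos[OF enat] by (simp add: cheb_def game_coeff_def enat field_simps)
qed (use st in \<open>simp add: cheb_def game_coeff_def\<close>)

lemma cheb_pos: "0 < n \<Longrightarrow> enat n < m s t \<Longrightarrow> cheb s t n > 0"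
  using sin_pos by (auto simp: cheb_def field_simps intro!: sin_gt_zero divide_pos_pos split: enat.splits)

lemma cheb_nonneg: "enat n \<le> m s t \<Longrightarrow> cheb s t n \<ge> 0"
  using sin_pos matrix_finite_ge2
  by (force simp: cheb_def field_simps intro!: sin_ge_zero divide_nonneg_pos split: enat.splits)

lemma cheb_periodic: "m s t = enat k \<Longrightarrow> cheb s t (n + 2 * k) = cheb s t n"
proof -
  assume k: "m s t = enat k"
  have "real (n + 2 * k) * pi / real k = real n * pi / real k + 2 * pi"
    using matrix_finite_ge2[OF k] by (simp add: field_simps)
  then show ?thesis by (simp add: cheb_def k)
qed

text \<open>The difference \<open>4 - (game_coeff s t)\<^sup>2\<close> is the determinant of twice
  the Gram matrix of the two simple roots.\<close>

lemma game_coeff_sq: "m s t = enat k \<Longrightarrow> (game_coeff s t)\<^sup>2 \<noteq> 4"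
  using sin_pos[of k] st sin_squared_eq[of "pi / real k"]
  by (auto simp: game_coeff_def power_mult_distrib)

text \<open>By periodicity the values at \<open>s\<close> and \<open>t\<close> return after
  \<open>2 * k\<close> moves. The accumulated change is a combination of two fixed directions, and
  its coefficients then lie in the kernel of the Gram matrix. They vanish, which restores the values
  at all other vertices too.\<close>

lemma play_relator:
  assumes k: "m s t = enat k"
  shows "play (concat (replicate k [s, t])) f = f"
proof -
  let ?a = "game_coeff s t"
  \<comment> \<open>Closed form of the amount fired at move \<open>n\<close>; \<open>play\<close>
    works from the right end of a word, so \<open>t\<close> moves first.\<close>
  define g where "g n = f t * cheb s t (Suc n) + f s * cheb s t n" for n
  have g0: "g 0 = f t" "g (Suc 0) = f s + ?a * f t"
    by (simp_all add: g_def cheb_0 cheb_1 cheb_rec)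
  have grec: "g (Suc (Suc n)) = ?a * g (Suc n) - g n" for n
    unfolding g_def cheb_rec[of "Suc n"] cheb_rec[of n] by (simp add: algebra_simps)
  \<comment> \<open>Total amounts fired from \<open>t\<close> and from \<open>s\<close> in the first
    \<open>j\<close> rounds.\<close>
  define E O' where "E j = (\<Sum>i<j. g (2 * i))" and "O' j = (\<Sum>i<j. g (Suc (2 * i)))" for j
  have E_t: "f t - 2 * E j + ?a * O' j = g (2 * j)"
    and E_s: "f s + ?a * E (Suc j) - 2 * O' j = g (Suc (2 * j))" for j
  proof -
    have "f t - 2 * E j + ?a * O' j = g (2 * j) \<and> f s + ?a * E (Suc j) - 2 * O' j = g (Suc (2 * j))"
    proof (induction j)
      case (Suc j)
      have 1: "f t - 2 * E (Suc j) + ?a * O' (Suc j) = g (2 * Suc j)"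
        using Suc grec[of "2 * j"] by (simp add: E_def O'_def algebra_simps)
      moreover have "f s + ?a * E (Suc (Suc j)) - 2 * O' (Suc j) = g (Suc (2 * Suc j))"
        using Suc grec[of "Suc (2 * j)"] by (simp add: E_def O'_def algebra_simps)
      ultimately show ?case by simp
    qed (simp add: E_def O'_def g0)
    then show "f t - 2 * E j + ?a * O' j = g (2 * j)"
      "f s + ?a * E (Suc j) - 2 * O' j = g (Suc (2 * j))" by auto
  qed
  have a: "game_coeff t s = ?a" by (rule game_coeff_sym[OF t s])
  have main: "play (concat (replicate j [s, t])) f = (\<lambda>r. f r + game_coeff t r * E j + game_coeff s r * O' j)" for j
  proof (induction j)
    case (Suc j)
    let ?p = "play (concat (replicate j [s, t])) f"
    have t1: "?p t = g (2 * j)" using E_t[of j] by (simp add: Suc)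
    have ft: "fire t ?p = (\<lambda>r. f r + game_coeff t r * E (Suc j) + game_coeff s r * O' j)"
      unfolding fire_def t1 by (simp add: Suc E_def algebra_simps)
    have s1: "fire t ?p s = g (Suc (2 * j))" unfolding ft using E_s[of j] a by simp
    have "fire s (fire t ?p) = (\<lambda>r. f r + game_coeff t r * E (Suc j) + game_coeff s r * O' (Suc j))"
      unfolding fire_def[of s] s1 by (simp add: ft O'_def algebra_simps)
    then show ?case by simp
  qed (simp add: E_def O'_def)
  have per: "g (n + 2 * k) = g n" for n
    using cheb_periodic[OF k, of n] cheb_periodic[OF k, of "Suc n"] by (simp add: g_def)
  have 1: "?a * O' k = 2 * E k"
    using E_t[of k] per[of 0] g0 by simp
  have 2: "?a * E k = 2 * O' k"
    using E_s[of k] per[of 0] per[of 1] g0 by (simp add: E_def algebra_simps)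
  have "?a * (?a * E k) = 2 * (?a * O' k)" using 2 by simp
  then have "?a\<^sup>2 * E k = 4 * E k" using 1 by (simp add: power2_eq_square mult.assoc)
  then have "E k = 0" using game_coeff_sq[OF k] by simp
  then show ?thesis using 2 by (simp add: main)
qed

end

lemma play_cong:
  assumes "set xs \<subseteq> S" "set ys \<subseteq> S" "lp xs = lp ys"
  shows "play xs = play ys"
proof (rule word_invariant[OF _ assms])
  fix a b s t k assume *: "s \<in> S" "t \<in> S" "m s t = enat k"
  have "play (concat (replicate k [s, t])) = (\<lambda>f. f)"
  proof (cases "s = t")
    case True
    then show ?thesis using * matrix_refl[of s] by (simp add: one_enat_def fun_eq_iff)
  qed (use play_relator * in \<open>simp add: fun_eq_iff\<close>)
  then show "play (a @ concat (replicate k [s, t]) @ b) = play (a @ b)"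
    by (simp add: play_append fun_eq_iff[of "play _"])
qed

section \<open>Alternating words and the dihedral case\<close>

fun alternating :: "'a \<Rightarrow> 'a \<Rightarrow> nat \<Rightarrow> 'a list" where
  "alternating s t 0 = []"
| "alternating s t (Suc n) = s # alternating t s n"

lemma length_alternating [simp]: "length (alternating s t n) = n"
  by (induction n arbitrary: s t) auto

lemma set_alternating: "set (alternating s t n) \<subseteq> {s, t}"
  by (induction n arbitrary: s t) auto

lemma alternating_append:
  "alternating s t (n + k) = alternating s t n @ (if even n then alternating s t k else alternating t s k)"
  by (induction n arbitrary: s t) auto

lemma alternating_snoc: "alternating s t (Suc n) = alternating s t n @ [if even n then s else t]"
  using alternating_append[of s t n 1] by simp

lemma rev_alternating: "rev (alternating s t n) = (if even n then alternating t s n else alternating s t n)"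
proof (induction n arbitrary: s t)
  case (Suc n)
  have "rev (alternating s t (Suc n)) = (if even n then alternating s t n else alternating t s n) @ [s]"
    using Suc[of t s] by simp
  also have "\<dots> = (if even (Suc n) then alternating t s (Suc n) else alternating s t (Suc n))"
    using alternating_snoc[of s t n] alternating_snoc[of t s n] by auto
  finally show ?case .
qed simp

lemma alternating_double: "alternating s t (2 * n) = concat (replicate n [s, t])"
  by (induction n) auto

text \<open>Cut the relator in the middle: its second half is the reversal of the other alternating
  word, hence represents its inverse.\<close>

lemma braid:
  assumes "s \<in> S" "t \<in> S" "m s t = enat k"
  shows "lp (alternating s t k) = lp (alternating t s k)"
proof -
  have set: "set (alternating s t k) \<subseteq> S" "set (alternating t s k) \<subseteq> S"
    using set_alternating[of s t k] set_alternating[of t s k] assms by auto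
  let ?b = "if even k then alternating s t k else alternating t s k"
  have b: "?b = rev (alternating t s k)" using rev_alternating[of t s k] by simp
  have "alternating s t (2 * k) = alternating s t k @ ?b"
    using alternating_append[of s t k k] by (simp add: mult_2)
  then have "lp (alternating s t k) \<otimes> lp ?b = \<one>"
    using relator_eval[OF assms] set by (simp add: alternating_double lp_append_S flip: lp_append_S)
  then have "lp (alternating s t k) \<otimes> inv (lp (alternating t s k)) = \<one>"
    unfolding b using set lp_rev by simp
  then show ?thesis using set by (metis inv_closed inv_equality inv_inv lp_S)
qed

text \<open>Each value is taken at the letter due to fire next and depends on the value of its
  partner one move earlier, so both starting letters share one two-step induction.\<close>

lemma play_alternating:
  assumes st: "s \<in> S" "t \<in> S" "s \<noteq> t"
  shows "play (alternating t s n) f s =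
      (if even n then cheb s t (Suc n) * f s + cheb s t n * f t
       else cheb s t (Suc n) * f t + cheb s t n * f s)
    \<and> play (alternating s t n) f t =
      (if even n then cheb s t (Suc n) * f t + cheb s t n * f s
       else cheb s t (Suc n) * f s + cheb s t n * f t)"
proof (induction n rule: induct_nat_012)
  case 0
  show ?case using cheb_0 cheb_1 st by simp
next
  case 1
  show ?case using cheb_0 cheb_1 cheb_rec[OF st] st game_coeff_sym[of s t]
    by (simp add: fire_def)
next
  case (ge2 n)
  have c: "game_coeff t s = game_coeff s t" using game_coeff_sym st by simp
  have step: "play (alternating t s (Suc (Suc n))) f s =
      game_coeff s t * play (alternating s t (Suc n)) f t - play (alternating t s n) f s"
    using c by (simp add: fire_def[of t])
  have step': "play (alternating s t (Suc (Suc n))) f t =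
      game_coeff s t * play (alternating t s (Suc n)) f s - play (alternating s t n) f t"
    by (simp add: fire_def[of s])
  note r = cheb_rec[OF st, of n] cheb_rec[OF st, of "Suc n"]
  show ?case unfolding step step' using ge2 by (auto simp: r algebra_simps)
qed

lemma play_alternating_pos:
  assumes st: "s \<in> S" "t \<in> S" "s \<noteq> t" and n: "enat n < m s t" and f: "f s > 0" "f t > 0"
  shows "play (alternating t s n) f s > 0"
proof -
  \<comment> \<open>When \<open>Suc n\<close> equals the bond, this coefficient is 0 because it
    contains \<open>sin pi\<close>; strictness then has to come from \<open>c3\<close>.\<close>
  have c1: "cheb s t (Suc n) \<ge> 0"
    using cheb_nonneg[OF st] n by (simp add: Suc_ile_eq)
  have c2: "cheb s t n \<ge> 0" using cheb_nonneg[OF st] n by simp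
  have c3: "cheb s t (Suc n) > 0 \<or> cheb s t n > 0"
    using cheb_pos[OF st, of n] cheb_1[OF st] n by (cases n) auto
  have "cheb s t (Suc n) * p + cheb s t n * q > 0" if "p > 0" "q > 0" for p q
    using c1 c2 c3 that by (metis add_nonneg_pos add_pos_nonneg less_imp_le mult_nonneg_nonneg mult_pos_pos)
  then show ?thesis using play_alternating[OF st, of n f] f by auto
qed

text \<open>Tits' theorem. Write \<open>w\<close> as an alternating word in \<open>s\<close>, \<open>t\<close> of maximal length followed
  by a shorter \<open>v\<close>, lengths adding up; both \<open>s\<close> and \<open>t\<close> are ascents of \<open>v\<close>, which reduces the
  claim to the dihedral group of \<open>s\<close> and \<open>t\<close>.\<close>

theorem play_pos:
  assumes "set xs \<subseteq> S" "s \<in> S" "len (lp xs) < len (s \<otimes> lp xs)" "\<And>r. r \<in> S \<Longrightarrow> f r > 0"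
  shows "play xs f s > 0"
  using assms
proof (induction "len (lp xs)" arbitrary: xs s rule: less_induct)
  case less
  let ?w = "lp xs"
  note xs = \<open>set xs \<subseteq> S\<close> and s = \<open>s \<in> S\<close> and up = \<open>len ?w < len (s \<otimes> ?w)\<close>
  have w: "?w \<in> carrier W" using xs by simp
  show ?case
  proof (cases "?w = \<one>")
    case True
    then have "play xs = play []" using play_cong[of xs "[]"] xs by simp
    then show ?thesis using less.prems by simp
  next
    case False
    obtain ys where ys: "set ys \<subseteq> S" "lp ys = ?w" "length ys = len ?w" by (rule reduced_word[OF w])
    then obtain t zs where tz: "ys = t # zs" using False by (cases ys) auto
    have t: "t \<in> S" and zs: "set zs \<subseteq> S" using ys tz by auto
    have lz: "len (lp zs) = length zs"
    proof -
      have "len ?w \<le> len (lp zs) + 1" using ys tz len_left[OF t, of "lp zs"] zs by auto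
      then show ?thesis using len_le[OF zs] ys tz by simp
    qed
    have st: "s \<noteq> t"
    proof
      assume "s = t"
      then have "s \<otimes> ?w = lp zs" using ys tz t zs by (metis S_cancel lp_Cons lp_S)
      then show False using up lz ys tz by simp
    qed
    define P where "P k \<longleftrightarrow> (\<exists>vs. set vs \<subseteq> S \<and> ?w = lp (alternating t s k @ vs) \<and> len ?w = k + len (lp vs))" for k
    have "P 1" unfolding P_def using ys tz zs lz by (intro exI[of _ zs]) auto
    moreover have bound: "\<forall>k. P k \<longrightarrow> k \<le> len ?w" by (auto simp: P_def)
    ultimately obtain k where k: "P k" and max: "\<And>j. P j \<Longrightarrow> j \<le> k"
      using GreatestI_nat[of P 1 "len ?w"] Greatest_le_nat[of P _ "len ?w"] by blast
    have k1: "k \<ge> 1" using max[OF \<open>P 1\<close>] .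
    obtain vs where vs: "set vs \<subseteq> S" "?w = lp (alternating t s k @ vs)" "len ?w = k + len (lp vs)"
      using k by (auto simp: P_def)
    have alt: "set (alternating a b j) \<subseteq> S" if "{a, b} = {s, t}" for a b j
      using set_alternating[of a b j] s t that by auto
    \<comment> \<open>A prefix as long as the bond could be rewritten by the braid relation to begin
      with \<open>s\<close>, making \<open>s\<close> a left descent of \<open>?w\<close>.\<close>
    have km: "enat k < m s t"
    proof (rule ccontr)
      assume "\<not> enat k < m s t"
      then obtain M where M: "m s t = enat M" "M \<le> k" by (cases "m s t") auto
      let ?rest = "(if even M then alternating t s (k - M) else alternating s t (k - M)) @ vs"
      have rs: "set ?rest \<subseteq> S" using alt vs by auto
      have M0: "M \<ge> 1" using matrix_finite_ge2[OF s t st M(1)] by simp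
      have "alternating t s k @ vs = alternating t s M @ ?rest"
        using alternating_append[of t s M "k - M"] M by simp
      then have "?w = lp (alternating t s M @ ?rest)" using vs by simp
      also have "\<dots> = lp (alternating s t M @ ?rest)"
        using braid[OF s t M(1)] rs alt by (simp only: lp_append_S insert_commute)
      also have "alternating s t M @ ?rest = s # (alternating t s (M - 1) @ ?rest)"
        using M0 by (cases M) auto
      finally have "?w = s \<otimes> lp (alternating t s (M - 1) @ ?rest)" by simp
      moreover have sub: "set (alternating t s (M - 1) @ ?rest) \<subseteq> S"
        using rs alt[of t s "M - 1"] by auto
      ultimately have "s \<otimes> ?w = lp (alternating t s (M - 1) @ ?rest)"
        using S_cancel[OF s] by simp
      then obtain ps where ps: "ps = alternating t s (M - 1) @ (if even M then alternating t s (k - M) else alternating s t (k - M))"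
        "s \<otimes> ?w = lp (ps @ vs)" "set ps \<subseteq> S" using sub by auto
      have "len (s \<otimes> ?w) \<le> len (lp ps) + len (lp vs)"
        using ps(2) lp_append_S[OF ps(3) vs(1)] len_mult[OF lp_S[OF ps(3)] lp_S[OF vs(1)]] by simp
      also have "\<dots> \<le> (k - 1) + len (lp vs)" using len_le[OF ps(3)] M M0 ps(1) by auto
      finally show False using up vs k1 by simp
    qed
    \<comment> \<open>\<open>?n\<close> would prolong the alternating prefix and \<open>?l\<close>
      is its last letter: a left descent of \<open>lp vs\<close> at \<open>?n\<close> contradicts
      the maximality of \<open>k\<close>, one at \<open>?l\<close> the additivity of
      lengths.\<close>
    let ?n = "if even k then t else s" and ?l = "if even k then s else t"
    have nl: "?n \<in> S" "?l \<in> S" using s t by auto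
    have vc: "lp vs \<in> carrier W" using vs by simp
    have next_up: "len (lp vs) < len (?n \<otimes> lp vs)"
    proof (rule ccontr)
      assume "\<not> ?thesis"
      then have l: "len (lp vs) = len (?n \<otimes> lp vs) + 1" using len_left[OF nl(1) vc] by auto
      have "lp (alternating t s (Suc k) @ (?n # vs)) = lp (alternating t s k @ [?n] @ (?n # vs))"
        by (simp only: alternating_snoc append_assoc)
      also have "\<dots> = lp (alternating t s k @ vs)"
      proof -
        have "set (alternating t s k) \<subseteq> S" by (rule alt) auto
        then show ?thesis using s t vs by (auto simp: lp_append_S S_cancel)
      qed
      finally have "?w = lp (alternating t s (Suc k) @ (?n # vs))" using vs by simp
      then have "P (Suc k)" unfolding P_def using vs l nl by (intro exI[of _ "?n # vs"]) auto
      then show False using max by fastforce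
    qed
    have last_up: "len (lp vs) < len (?l \<otimes> lp vs)"
    proof (rule ccontr)
      assume "\<not> ?thesis"
      then have l: "len (lp vs) = len (?l \<otimes> lp vs) + 1" using len_left[OF nl(2) vc] by auto
      have "alternating t s k = alternating t s (k - 1) @ [?l]"
        using alternating_snoc[of t s "k - 1"] k1 by (cases k) auto
      then have "?w = lp (alternating t s (k - 1) @ (?l # vs))" using vs(2) by simp
      also have "\<dots> = lp (alternating t s (k - 1)) \<otimes> lp (?l # vs)"
        using vs(1) nl(2) by (intro lp_append_S alt) auto
      finally have "?w = lp (alternating t s (k - 1)) \<otimes> (?l \<otimes> lp vs)" by simp
      moreover have a: "set (alternating t s (k - 1)) \<subseteq> S" by (rule alt) auto
      ultimately have "len ?w \<le> len (lp (alternating t s (k - 1))) + len (?l \<otimes> lp vs)"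
        using len_mult[OF lp_S[OF a] m_closed[OF S_closed[OF nl(2)] vc]] by metis
      then show False using l vs(3) k1 len_le[OF a] by (simp only: length_alternating)
    qed
    have "len (lp vs) < len (s \<otimes> lp vs)" "len (lp vs) < len (t \<otimes> lp vs)"
      using next_up last_up by (auto split: if_splits)
    then have "play vs f s > 0" "play vs f t > 0"
      using less.hyps[of vs] vs k1 s t less.prems(4) by auto
    then have "play (alternating t s k) (play vs f) s > 0"
      using play_alternating_pos[OF s t st km] by simp
    moreover have "play xs = play (alternating t s k @ vs)"
      using vs xs alt[of t s k] by (intro play_cong) auto
    ultimately show ?thesis by (simp add: play_append)
  qed
qed

lemma play_neg:
  assumes "set xs \<subseteq> S" "s \<in> S" "len (s \<otimes> lp xs) < len (lp xs)" "\<And>r. r \<in> S \<Longrightarrow> f r > 0"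
  shows "play xs f s < 0"
proof -
  have "s \<otimes> lp (s # xs) = lp xs" using assms by (simp add: S_cancel)
  then have "play (s # xs) f s > 0"
    using play_pos[of "s # xs" s f] assms by auto
  then show ?thesis by simp
qed

lemma descent_iff_play:
  assumes "set xs \<subseteq> S" "s \<in> S" "\<And>r. r \<in> S \<Longrightarrow> f r > 0"
  shows "len (s \<otimes> lp xs) < len (lp xs) \<longleftrightarrow> play xs f s < 0"
    and "len (lp xs) < len (s \<otimes> lp xs) \<longleftrightarrow> play xs f s > 0"
    and "play xs f s \<noteq> 0"
  using play_pos[of xs s f] play_neg[of xs s f] assms len_left[of s "lp xs"] by fastforce+

section \<open>Longest elements and the pop-stack-sorting operator\<close>

lemma play_uminus: "play xs (\<lambda>r. - f r) = (\<lambda>r. - play xs f r)"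
  by (induction xs) (simp_all add: fire_def)

lemma play_local:
  assumes "set xs \<subseteq> J" "s \<in> J" "\<And>r. r \<in> J \<Longrightarrow> f r = g r"
  shows "play xs f s = play xs g s"
  using assms by (induction xs arbitrary: s) (auto simp: fire_def)

text \<open>The position after \<open>v\<close> is negative on \<open>J\<close>. Its negative is a
  positive start for the game on \<open>J\<close>, so every ascent met while building
  \<open>z\<close> becomes a descent once \<open>v\<close> is multiplied on the right.\<close>

lemma len_mult_longest:
  assumes J: "J \<subseteq> S" and v: "v \<in> carrier W" and desc: "\<And>s. s \<in> J \<Longrightarrow> len (s \<otimes> v) < len v"
    and z: "z \<in> para J"
  shows "len (z \<otimes> v) + len z = len v"
proof -
  obtain vs where vs: "set vs \<subseteq> S" "lp vs = v" by (metis reduced_word[OF v])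
  obtain zs where zs: "set zs \<subseteq> J" "lp zs = z" "length zs = len z" by (rule para_reduced[OF J z])
  have "set zs \<subseteq> J \<Longrightarrow> length zs = len (lp zs) \<Longrightarrow> len (lp zs \<otimes> v) + length zs = len v" for zs
  proof (induction zs)
    case (Cons s zs)
    have s: "s \<in> J" "s \<in> S" and zJ: "set zs \<subseteq> J" and zS: "set zs \<subseteq> S"
      using Cons.prems J by auto
    have red: "length zs = len (lp zs)" and up: "len (lp zs) < len (s \<otimes> lp zs)"
      using Cons.prems(2) len_le[OF zS] len_left[OF s(2) lp_S[OF zS]] by auto
    \<comment> \<open>The value 1 off \<open>J\<close> provides positivity on all of
      \<open>S\<close>; moves inside \<open>J\<close> never read it.\<close>
    define f where "f r = (if r \<in> J then - play vs (\<lambda>_. 1) r else 1)" for r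
    have fpos: "f r > 0" if "r \<in> S" for r
      using that desc play_neg[OF vs(1), of r "\<lambda>_. 1"] vs(2) by (auto simp: f_def)
    have "play zs f s > 0" by (rule play_pos[OF zS s(2) up fpos])
    moreover have "play zs f s = - play zs (play vs (\<lambda>_. 1)) s"
      using play_local[OF zJ s(1), of f "\<lambda>r. - play vs (\<lambda>_. 1) r"]
      by (simp add: f_def play_uminus)
    ultimately have "play (zs @ vs) (\<lambda>_. 1) s < 0" by (simp add: play_append)
    then have "len (s \<otimes> lp (zs @ vs)) < len (lp (zs @ vs))"
      using descent_iff_play(1)[of "zs @ vs" s "\<lambda>_. 1"] zS vs s by simp
    then have "len (s \<otimes> (lp zs \<otimes> v)) < len (lp zs \<otimes> v)"
      using zS vs by (simp add: lp_append_S)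
    then have "len (lp zs \<otimes> v) = len (s \<otimes> (lp zs \<otimes> v)) + 1"
      using len_left[OF s(2), of "lp zs \<otimes> v"] zS v by auto
    then show ?case using Cons.IH[OF zJ red] zS v s by (simp add: m_assoc)
  qed (use v in simp)
  then show ?thesis using zs by metis
qed

lemma len_mult_longest_right:
  assumes J: "J \<subseteq> S" and v: "v \<in> carrier W" and desc: "\<And>s. s \<in> J \<Longrightarrow> len (v \<otimes> s) < len v"
    and z: "z \<in> para J"
  shows "len (v \<otimes> z) + len z = len v"
proof -
  have zc: "z \<in> carrier W" using para_closed J z by blast
  have "len (inv z \<otimes> inv v) + len (inv z) = len (inv v)"
    using J v desc para_inv[OF J z] by (intro len_mult_longest[OF J]) (auto simp: len_right_inv subset_iff)
  moreover have "inv z \<otimes> inv v = inv (v \<otimes> z)" using v zc by (simp add: inv_mult_group)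
  ultimately show ?thesis using v zc by simp
qed

text \<open>Passing from \<open>u\<close> to \<open>v\<close> and back from \<open>v\<close> to
  \<open>u\<close> lowers the length each time by that of the connecting factor, so this factor has
  length 0.\<close>

lemma longest_unique:
  assumes J: "J \<subseteq> S" and u: "u \<in> para J" "\<And>s. s \<in> J \<Longrightarrow> len (u \<otimes> s) < len u"
    and v: "v \<in> para J" "\<And>s. s \<in> J \<Longrightarrow> len (v \<otimes> s) < len v"
  shows "u = v"
proof -
  have c: "u \<in> carrier W" "v \<in> carrier W" using para_closed J u v by auto
  let ?z = "inv u \<otimes> v"
  have z: "?z \<in> para J" using para_mult[OF J para_inv[OF J u(1)] v(1)] .
  have iz: "inv ?z \<in> para J" using para_inv[OF J z] .
  have "u \<otimes> ?z = v" "v \<otimes> inv ?z = u"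
    using c by (simp_all add: inv_mult_group flip: m_assoc)
  then have "len v + len ?z = len u" "len u + len (inv ?z) = len v"
    using len_mult_longest_right[OF J c(1) u(2) z] len_mult_longest_right[OF J c(2) v(2) iz] by auto
  then have "?z = \<one>" using c len_eq_0[of ?z] by auto
  then show ?thesis using c by (metis inv_closed inv_equality inv_inv)
qed

section \<open>Meets in the weak order and the pop operator\<close>

abbreviation "desc \<equiv> right_descents W S"
abbreviation "pop \<equiv> coxeter_pop W S"

lemma desc_subset: "desc w \<subseteq> S"
  by (auto simp: right_descents_def)

lemma desc_iff: "s \<in> desc w \<longleftrightarrow> s \<in> S \<and> len (w \<otimes> s) < len w"
  by (simp add: right_descents_def)

lemma weak_le_iff: "x \<sqsubseteq>\<^bsub>right_weak_order W S\<^esub> y \<longleftrightarrow> len (inv x \<otimes> y) + len x = len y"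
  by (auto simp: right_weak_order_def)

text \<open>A lower bound \<open>y\<close> of \<open>w\<close> and all \<open>ws\<close> has \<open>y\<^sup>-\<^sup>1 w = z v\<close> with \<open>v\<close> in the parabolic
  subgroup of the descents and \<open>z\<close> minimal in its coset; an ascent \<open>s\<close> of \<open>v\<close> would contradict
  \<open>y \<le> ws\<close>, so \<open>v\<close> is the longest element \<open>u\<close> and \<open>y \<le> yz = x\<close>.\<close>

lemma pop_eqI:
  assumes x: "x \<in> carrier W" and u: "u \<in> para (desc (x \<otimes> u))"
    and min: "\<And>s. s \<in> desc (x \<otimes> u) \<Longrightarrow> len x < len (x \<otimes> s)"
  shows "pop (x \<otimes> u) = x"
proof -
  let ?w = "x \<otimes> u" and ?J = "desc (x \<otimes> u)" and ?L = "right_weak_order W S"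
  note J = desc_subset[of ?w]
  have uc: "u \<in> carrier W" using para_closed J u by blast
  have add: "len (x \<otimes> v) = len x + len v" if "v \<in> para ?J" for v
    by (rule minimal_additive[OF J x min that])
  let ?A = "{?w \<otimes> s | s. s \<in> ?J} \<union> {?w}"
  have sJ: "s \<in> S" "u \<otimes> s \<in> para ?J" if "s \<in> ?J" for s
    using that J para_mult[OF J u para_gen[OF J that]] by auto
  have udesc: "len (u \<otimes> s) < len u" if "s \<in> ?J" for s
    using that add[OF sJ(2)[OF that]] add[OF u] sJ(1)[OF that] x uc by (simp add: desc_iff m_assoc)
  have xw: "inv x \<otimes> (x \<otimes> v) = v" if "v \<in> carrier W" for v
    using x that by (simp flip: m_assoc)
  have lower: "x \<in> Lower ?L ?A"
  proof -
    have "x \<sqsubseteq>\<^bsub>?L\<^esub> ?w \<otimes> s" if "s \<in> ?J" for s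
      using add[OF sJ(2)[OF that]] sJ(1)[OF that] x uc xw[of "u \<otimes> s"] by (simp add: weak_le_iff m_assoc)
    moreover have "x \<sqsubseteq>\<^bsub>?L\<^esub> ?w" using add[OF u] xw uc by (simp add: weak_le_iff)
    ultimately show ?thesis using x by (auto simp: Lower_def right_weak_order_def)
  qed
  have below: "y \<in> carrier W \<and> y \<sqsubseteq>\<^bsub>?L\<^esub> x" if y: "y \<in> Lower ?L ?A" for y
  proof -
    have yc: "y \<in> carrier W" using y by (auto simp: Lower_def right_weak_order_def)
    have yle: "y \<sqsubseteq>\<^bsub>?L\<^esub> a" if "a \<in> ?A" for a
      using y that x uc sJ(1) by (auto simp: Lower_def right_weak_order_def)
    let ?z = "inv y \<otimes> ?w"
    have zc: "?z \<in> carrier W" using yc x uc by simp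
    obtain z v where z: "z \<in> carrier W" "v \<in> para ?J" "?z = z \<otimes> v"
      "\<forall>v\<in>para ?J. len (z \<otimes> v) = len z + len v"
      by (rule parabolic_decomposition[OF J zc])
    have vc: "v \<in> carrier W" using para_closed J z by blast
    have lw: "len ?z + len y = len ?w" using yle[of ?w] by (simp add: weak_le_iff)
    have "len (v \<otimes> s) < len v" if s: "s \<in> ?J" for s
    proof (rule ccontr)
      assume "\<not> ?thesis"
      then have "len (v \<otimes> s) = len v + 1" using len_right[of s v] sJ(1)[OF s] vc by auto
      moreover have "len (z \<otimes> (v \<otimes> s)) = len z + len (v \<otimes> s)"
        using z(4) para_mult[OF J z(2) para_gen[OF J s]] by blast
      ultimately have "len (?z \<otimes> s) = len ?z + 1"
        using z vc sJ(1)[OF s] by (simp add: m_assoc)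
      moreover have "len (inv y \<otimes> (?w \<otimes> s)) + len y = len (?w \<otimes> s)"
        using yle[of "?w \<otimes> s"] s unfolding weak_le_iff by blast
      ultimately show False using lw s yc x uc sJ(1)[OF s] by (simp add: desc_iff m_assoc)
    qed
    then have vu: "v = u" using longest_unique[OF J z(2) _ u udesc] by blast
    have "?w = y \<otimes> (z \<otimes> u)" using z(3) vu yc x uc by (metis inv_solve_left m_closed z(1))
    then have "x = y \<otimes> z" using yc x uc z(1) by (simp flip: m_assoc)
    then have "inv y \<otimes> x = z" using yc z(1) by (simp flip: m_assoc)
    moreover have "len z + len y = len x"
      using lw add[OF u] z vu u by simp
    ultimately show ?thesis using yc by (simp add: weak_le_iff)
  qed
  have great: "greatest ?L x (Lower ?L ?A)"
    using lower below x by (auto simp: greatest_def)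
  \<comment> \<open>The meet is a chosen greatest lower bound, so its value is known only after
    uniqueness.\<close>
  have "y = x" if "greatest ?L y (Lower ?L ?A)" for y
  proof -
    have y: "y \<in> carrier W" "y \<sqsubseteq>\<^bsub>?L\<^esub> x" "x \<sqsubseteq>\<^bsub>?L\<^esub> y"
      using that below lower by (auto simp: greatest_def)
    then have "len (inv x \<otimes> y) = 0" by (simp add: weak_le_iff)
    then have "inv x \<otimes> y = \<one>" using x y len_eq_0 by simp
    then show ?thesis using x y by (metis inv_closed inv_equality inv_inv)
  qed
  then show ?thesis
    unfolding coxeter_pop_def Lattice.inf_def using great by (intro some_equality) auto
qed

lemma pop_decomposition:
  assumes w: "w \<in> carrier W"
  obtains u where "pop w \<in> carrier W" "u \<in> para (desc w)" "w = pop w \<otimes> u"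
    "\<forall>v\<in>para (desc w). len (pop w \<otimes> v) = len (pop w) + len v"
    "\<forall>s\<in>desc w. len (u \<otimes> s) < len u"
proof -
  note J = desc_subset[of w]
  obtain x u where x: "x \<in> carrier W" "u \<in> para (desc w)" "w = x \<otimes> u"
    "\<forall>v\<in>para (desc w). len (x \<otimes> v) = len x + len v"
    by (rule parabolic_decomposition[OF J w])
  have uc: "u \<in> carrier W" using para_closed J x by blast
  have "len x < len (x \<otimes> s)" if "s \<in> desc w" for s
    using that x(4) para_gen[OF J that] J by auto
  then have p: "pop w = x" using pop_eqI[of x u] x by simp
  have "len (u \<otimes> s) < len u" if "s \<in> desc w" for s
  proof -
    have "len (x \<otimes> (u \<otimes> s)) = len x + len (u \<otimes> s)"
      using para_mult[OF J x(2) para_gen[OF J that]] x(4) by blast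
    moreover have "len (w \<otimes> s) < len w" "s \<in> S" using that by (auto simp: desc_iff)
    ultimately show ?thesis using x uc by (simp add: m_assoc)
  qed
  then show thesis using that[of u] x p by simp
qed

lemma pop_closed [simp]: "w \<in> carrier W \<Longrightarrow> pop w \<in> carrier W"
  by (metis pop_decomposition)

lemma pop_one [simp]: "pop \<one> = \<one>"
  using pop_eqI[of \<one> \<one>] by (simp add: desc_iff)

lemma pop_less: "w \<in> carrier W \<Longrightarrow> w \<noteq> \<one> \<Longrightarrow> len (pop w) < len w"
proof -
  assume w: "w \<in> carrier W" "w \<noteq> \<one>"
  then obtain s where s: "s \<in> desc w"
    using right_descent_exists[of S w] carrier_para by (auto simp: desc_iff)
  obtain u where u: "u \<in> para (desc w)" "w = pop w \<otimes> u"
    "\<forall>v\<in>para (desc w). len (pop w \<otimes> v) = len (pop w) + len v" "\<forall>s\<in>desc w. len (u \<otimes> s) < len u"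
    by (rule pop_decomposition[OF w(1)])
  have "len u > 0" using u(4) s by fastforce
  moreover have "len w = len (pop w) + len u" using u by metis
  ultimately show ?thesis by simp
qed

section \<open>Orbit sizes\<close>

lemma pop_funpow_closed [simp]: "w \<in> carrier W \<Longrightarrow> (pop ^^ n) w \<in> carrier W"
  by (induction n) auto

lemma pop_funpow_one: "(pop ^^ n) w = \<one> \<Longrightarrow> n \<le> k \<Longrightarrow> (pop ^^ k) w = \<one>"
proof -
  assume n: "(pop ^^ n) w = \<one>" "n \<le> k"
  have "(pop ^^ (j + n)) w = \<one>" for j using n by (induction j) auto
  then show ?thesis using n(2) by (metis le_add_diff_inverse2)
qed

lemma orbit_eq:
  assumes "(pop ^^ n) w = \<one>"
  shows "forward_orbit pop w = (\<lambda>j. (pop ^^ j) w) ` {..n}"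
proof -
  have "(pop ^^ k) w \<in> (\<lambda>j. (pop ^^ j) w) ` {..n}" for k
    using pop_funpow_one[OF assms, of k] assms by (cases "k \<le> n") force+
  then show ?thesis by (auto simp: forward_orbit_def)
qed

lemma orbit_le:
  assumes "(pop ^^ n) w = \<one>" shows "ecard (forward_orbit pop w) \<le> enat (Suc n)"
  using card_image_le[of "{..n}" "\<lambda>j. (pop ^^ j) w"] by (simp add: orbit_eq[OF assms] ecard_def)

lemma pop_funpow_len: "w \<in> carrier W \<Longrightarrow> (\<forall>j<n. (pop ^^ j) w \<noteq> \<one>) \<Longrightarrow> i < j \<Longrightarrow> j \<le> n \<Longrightarrow>
  len ((pop ^^ j) w) < len ((pop ^^ i) w)"
proof (induction j)
  case (Suc j)
  then have "len ((pop ^^ Suc j) w) < len ((pop ^^ j) w)"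
    using pop_less[of "(pop ^^ j) w"] by simp
  then show ?case using Suc by (cases "i = j") auto
qed simp

text \<open>Lengths drop strictly until the identity is met, so the iterates up to index
  \<open>n\<close> are distinct; the last one may already be the identity, hence
  \<open>Suc n\<close>.\<close>

lemma orbit_ge:
  assumes w: "w \<in> carrier W" and n: "\<forall>j<n. (pop ^^ j) w \<noteq> \<one>"
  shows "enat (Suc n) \<le> ecard (forward_orbit pop w)"
proof -
  let ?f = "\<lambda>j. (pop ^^ j) w"
  have "inj_on ?f {..n}"
    using pop_funpow_len[OF w n] by (intro linorder_inj_onI') force
  then have "card (?f ` {..n}) = Suc n" by (simp add: card_image)
  moreover have "?f ` {..n} \<subseteq> forward_orbit pop w" by (auto simp: forward_orbit_def)
  ultimately show ?thesis
    by (metis card_mono ecard_def enat_ord_simps(1) enat_ord_simps(3))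
qed

section \<open>Subwords\<close>

text \<open>For reduced \<open>q\<close> this is the Bruhat interval below \<open>lp q\<close>.
  Phrased with subwords, its properties come directly from the exchange condition.\<close>

definition subword_set :: "'a list \<Rightarrow> 'a set" where
  "subword_set q = lp ` {zs. subseq zs q}"

lemma subword_set_closed: "set q \<subseteq> S \<Longrightarrow> x \<in> subword_set q \<Longrightarrow> x \<in> carrier W"
  using subseq_set by (fastforce simp: subword_set_def)

lemma subword_self: "lp q \<in> subword_set q"
  by (auto simp: subword_set_def)

lemma subword_para: "set q \<subseteq> J \<Longrightarrow> subword_set q \<subseteq> para J"
  using subseq_set by (fastforce simp: subword_set_def para_iff)

lemma subword_descend:
  assumes "set q \<subseteq> S" "x \<in> subword_set q" "s \<in> S" "len (x \<otimes> s) < len x"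
  shows "x \<otimes> s \<in> subword_set q"
proof -
  obtain zs where zs: "subseq zs q" "lp zs = x" using assms by (auto simp: subword_set_def)
  then have "set zs \<subseteq> S" using subseq_set assms(1) by blast
  then obtain i where "x \<otimes> s = lp (delete_nth i zs)" using exchange_right[of zs s] assms zs by auto
  then show ?thesis using zs subseq_delete_nth[of i zs] subseq_order.order_trans
    by (auto simp: subword_set_def)
qed

text \<open>Downward closure in the right weak order: the total drop is \<open>len z\<close>, so
  each letter of a reduced word of \<open>z\<close> must shorten the product, and
  \<open>subword_descend\<close> applies letter by letter.\<close>

lemma subword_weak:
  assumes q: "set q \<subseteq> S" and x: "x \<in> subword_set q" and z: "z \<in> carrier W"
    and l: "len (x \<otimes> z) + len z = len x"
  shows "x \<otimes> z \<in> subword_set q"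
proof -
  note xc = subword_set_closed[OF q x]
  have "set zs \<subseteq> S \<Longrightarrow> len (x \<otimes> lp zs) + length zs = len x \<Longrightarrow> x \<otimes> lp zs \<in> subword_set q" for zs
  proof (induction zs rule: rev_induct)
    case (snoc s zs)
    have zs: "set zs \<subseteq> S" "s \<in> S" using snoc.prems by auto
    then have e: "x \<otimes> lp (zs @ [s]) = x \<otimes> lp zs \<otimes> s" using xc by (simp add: lp_append_S m_assoc)
    have "len x \<le> len (x \<otimes> lp zs) + length zs"
    proof -
      have "x = (x \<otimes> lp zs) \<otimes> inv (lp zs)" using xc zs by (simp add: m_assoc)
      then have "len x \<le> len (x \<otimes> lp zs) + len (inv (lp zs))"
        using len_mult[of "x \<otimes> lp zs" "inv (lp zs)"] xc zs by simp
      then show ?thesis using len_le[OF zs(1)] zs by simp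
    qed
    then have "len (x \<otimes> lp zs) + length zs = len x" "len (x \<otimes> lp zs \<otimes> s) < len (x \<otimes> lp zs)"
      using snoc.prems(2) len_right[OF zs(2), of "x \<otimes> lp zs"] xc zs unfolding e by auto
    then show ?case unfolding e using subword_descend[OF q snoc.IH[OF zs(1)] zs(2)] by blast
  qed (use x xc in simp)
  moreover obtain zs where "set zs \<subseteq> S" "lp zs = z" "length zs = len z" by (rule reduced_word[OF z])
  ultimately show ?thesis using l by auto
qed

text \<open>The lifting property. In the delicate case the subword ends in \<open>s\<close> although
  \<open>s\<close> is not a descent of \<open>x\<close>; then \<open>s\<close> is a descent of the
  product of the other letters, and exchange finds \<open>x\<close> inside \<open>q\<close>.\<close>

lemma subword_snoc:
  assumes q: "set q \<subseteq> S" and s: "s \<in> S" and x: "x \<in> subword_set (q @ [s])"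
  shows "if len (x \<otimes> s) < len x then x \<otimes> s \<in> subword_set q else x \<in> subword_set q"
proof -
  obtain zs where zs: "subseq zs (q @ [s])" "lp zs = x" using x by (auto simp: subword_set_def)
  then obtain a b where ab: "zs = a @ b" "subseq a q" "subseq b [s]"
    by (metis subseq_appendE)
  have aS: "set a \<subseteq> S" using subseq_set ab(2) q by blast
  have am: "lp a \<in> subword_set q" using ab by (auto simp: subword_set_def)
  have "b = [] \<or> b = [s]" using ab(3) by (cases b) (auto split: if_splits elim: list_emb.cases)
  then show ?thesis
  proof
    assume "b = []"
    then have "x = lp a" using ab zs by simp
    then show ?thesis using am subword_descend[OF q am s] by simp
  next
    assume "b = [s]"
    then have xe: "x = lp a \<otimes> s" "x \<otimes> s = lp a" using ab zs aS s by (auto simp: lp_append_S S_cancel_right)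
    show ?thesis
    proof (cases "len (x \<otimes> s) < len x")
      case False
      then have "len (lp a \<otimes> s) < len (lp a)" using xe len_right[OF s, of "lp a"] aS by auto
      then show ?thesis using subword_descend[OF q am s] xe False by simp
    qed (use xe am in simp)
  qed
qed

text \<open>The letters of \<open>ys\<close> are removed from the right, multiplying by those that
  are descents at that time. By commutation a letter found to be a descent later was already one of
  \<open>w\<close>, so \<open>v\<close> consists of descents of \<open>w\<close>.\<close>

lemma subword_commuting:
  assumes "set q \<subseteq> S" "set ys \<subseteq> S" "\<And>a b. a \<in> set ys \<Longrightarrow> b \<in> set ys \<Longrightarrow> a \<otimes> b = b \<otimes> a"
    "w \<in> subword_set (q @ ys)"
  shows "\<exists>v\<in>para (desc w). w \<otimes> v \<in> subword_set q"
proof -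
  \<comment> \<open>The induction also needs the letters of \<open>v\<close> to come from
    \<open>ys\<close>, since these commute with the removed letter.\<close>
  have "\<exists>v\<in>para (desc w \<inter> set ys). w \<otimes> v \<in> subword_set q"
    using assms
  proof (induction ys arbitrary: w rule: rev_induct)
    case Nil
    then show ?case using subword_set_closed[of q w] by (intro bexI[of _ \<one>]) auto
  next
    case (snoc y ys)
    have y: "y \<in> S" and ys: "set ys \<subseteq> S" and qy: "set (q @ ys) \<subseteq> S" using snoc.prems by auto
    have w: "w \<in> carrier W"
      using subword_set_closed[of "q @ ys @ [y]" w] snoc.prems by auto
    have com: "a \<otimes> b = b \<otimes> a" if "a \<in> set ys" "b \<in> set ys" for a b
      using snoc.prems(3) that by simp
    show ?case
    proof (cases "len (w \<otimes> y) < len w")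
      case True
      then have "w \<otimes> y \<in> subword_set (q @ ys)"
        using subword_snoc[OF qy y, of w] snoc.prems(4) by simp
      then obtain v where v: "v \<in> para (desc (w \<otimes> y) \<inter> set ys)" "w \<otimes> y \<otimes> v \<in> subword_set q"
        using snoc.IH[OF snoc.prems(1) ys com] by blast
      have "desc (w \<otimes> y) \<inter> set ys \<subseteq> desc w \<inter> set (ys @ [y])"
      proof
        fix a assume a: "a \<in> desc (w \<otimes> y) \<inter> set ys"
        then have aS: "a \<in> S" and "len (w \<otimes> y \<otimes> a) < len (w \<otimes> y)" by (auto simp: desc_iff)
        moreover have "w \<otimes> y \<otimes> a = w \<otimes> a \<otimes> y"
          using snoc.prems(3)[of y a] a aS y w by (simp add: m_assoc)
        ultimately have "len (w \<otimes> a) < len w"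
          using True len_right[OF y w] len_right[OF y, of "w \<otimes> a"] w by auto
        then show "a \<in> desc w \<inter> set (ys @ [y])" using a aS by (simp add: desc_iff)
      qed
      then have "v \<in> para (desc w \<inter> set (ys @ [y]))" using v para_mono by blast
      moreover have J: "desc w \<inter> set (ys @ [y]) \<subseteq> S" using desc_subset by blast
      moreover have "y \<in> para (desc w \<inter> set (ys @ [y]))"
        using True y by (intro para_gen[OF J]) (simp add: desc_iff)
      ultimately have "y \<otimes> v \<in> para (desc w \<inter> set (ys @ [y]))" by (intro para_mult)
      moreover have "v \<in> carrier W" using para_closed[OF J] \<open>v \<in> para (desc w \<inter> set (ys @ [y]))\<close> by blast
      ultimately show ?thesis using v w y by (intro bexI[of _ "y \<otimes> v"]) (simp_all add: m_assoc)
    next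
      case False
      then have "w \<in> subword_set (q @ ys)"
        using subword_snoc[OF qy y, of w] snoc.prems(4) by simp
      then obtain v where v: "v \<in> para (desc w \<inter> set ys)" "w \<otimes> v \<in> subword_set q"
        using snoc.IH[OF snoc.prems(1) ys com] by blast
      moreover have "para (desc w \<inter> set ys) \<subseteq> para (desc w \<inter> set (ys @ [y]))"
        by (rule para_mono) auto
      ultimately show ?thesis by blast
    qed
  qed
  moreover have "para (desc w \<inter> set ys) \<subseteq> para (desc w)" by (rule para_mono) auto
  ultimately show ?thesis by blast
qed

text \<open>The element \<open>w \<otimes> v\<close> lies in the coset whose minimum is
  \<open>pop w\<close>, so \<open>pop w\<close> is weakly below it and \<open>subword_weak\<close>
  applies.\<close>

lemma subword_pop:
  assumes q: "set q \<subseteq> S" and ys: "set ys \<subseteq> S" "\<And>a b. a \<in> set ys \<Longrightarrow> b \<in> set ys \<Longrightarrow> a \<otimes> b = b \<otimes> a"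
    and w: "w \<in> subword_set (q @ ys)"
  shows "pop w \<in> subword_set q"
proof -
  note J = desc_subset[of w]
  have wc: "w \<in> carrier W" using subword_set_closed[of "q @ ys" w] q ys w by auto
  obtain v where v: "v \<in> para (desc w)" "w \<otimes> v \<in> subword_set q"
    using subword_commuting[OF q ys w] by blast
  obtain u where u: "pop w \<in> carrier W" "u \<in> para (desc w)" "w = pop w \<otimes> u"
    "\<forall>v\<in>para (desc w). len (pop w \<otimes> v) = len (pop w) + len v"
    by (rule pop_decomposition[OF wc])
  have c: "u \<in> carrier W" "v \<in> carrier W" using para_closed J u v by auto
  have "w \<otimes> v = pop w \<otimes> (u \<otimes> v)" using u c by (metis m_assoc)
  moreover have "u \<otimes> v \<in> para (desc w)" using para_mult[OF J u(2) v(1)] .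
  ultimately have l: "len (w \<otimes> v) = len (pop w) + len (u \<otimes> v)" using u(4) by simp
  have e: "(w \<otimes> v) \<otimes> inv (u \<otimes> v) = pop w"
    using \<open>w \<otimes> v = pop w \<otimes> (u \<otimes> v)\<close> c u(1) by (simp add: m_assoc)
  show ?thesis
    using subword_weak[OF q v(2), of "inv (u \<otimes> v)"] l c unfolding e by simp
qed

lemma subword_longest:
  assumes q: "set q \<subseteq> S" and d: "desc (lp q) = S" and w: "w \<in> carrier W"
  shows "w \<in> subword_set q"
proof -
  have qc: "lp q \<in> carrier W" using q by simp
  let ?z = "inv (lp q) \<otimes> w"
  have "len (lp q \<otimes> ?z) + len ?z = len (lp q)"
  proof (rule len_mult_longest_right[OF subset_refl qc])
    show "len (lp q \<otimes> s) < len (lp q)" if "s \<in> S" for s using d that by (auto simp: desc_iff)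
    show "?z \<in> para S" using qc w carrier_para by auto
  qed
  moreover have "lp q \<otimes> ?z = w" using qc w by (simp flip: m_assoc)
  ultimately show ?thesis
    using subword_weak[OF q subword_self, of ?z] qc w by simp
qed

section \<open>Finite parabolic subgroups\<close>

lemma longest_exists:
  assumes J: "J \<subseteq> S" and fin: "finite (para J)"
  obtains w where "w \<in> para J" "\<forall>s\<in>J. len (s \<otimes> w) < len w"
proof -
  have ne: "para J \<noteq> {}" using para_one by blast
  obtain w where w: "w \<in> para J" "len w = Max (len ` para J)"
    using Max_in[of "len ` para J"] fin ne by fastforce
  have wc: "w \<in> carrier W" using para_closed J w by blast
  have "len (s \<otimes> w) < len w" if "s \<in> J" for s
  proof -
    have "s \<otimes> w \<in> para J" using para_mult[OF J para_gen[OF J that] w(1)] .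
    then have "len (s \<otimes> w) \<le> len w" using w(2) fin by simp
    then show ?thesis using len_left[of s w] wc that J by auto
  qed
  then show thesis using that w by blast
qed

text \<open>Along a reduced word of the longest element, starting from the constant function \<open>1\<close>, the
  weighted sum with weights \<open>n\<close> never decreases; but the final position is negative everywhere.\<close>

lemma no_subinvariant_weights:
  assumes I: "I \<subseteq> S" "finite I" and fin: "finite (para I)"
    and n: "\<And>r. r \<in> I \<Longrightarrow> n r \<ge> (0::real)" "i \<in> I" "n i > 0"
    and sub: "\<And>s. s \<in> I \<Longrightarrow> (\<Sum>r\<in>I. n r * game_coeff s r) \<ge> 0"
  shows False
proof -
  obtain w where w: "w \<in> para I" "\<forall>s\<in>I. len (s \<otimes> w) < len w"
    by (rule longest_exists[OF I(1) fin])
  obtain xs where xs: "set xs \<subseteq> I" "lp xs = w" "length xs = len w" by (rule para_reduced[OF I(1) w(1)])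
  define \<phi> where "\<phi> f = (\<Sum>r\<in>I. n r * f r)" for f :: "'a \<Rightarrow> real"
  have "set zs \<subseteq> I \<Longrightarrow> length zs = len (lp zs) \<Longrightarrow> \<phi> (play zs (\<lambda>_. 1)) \<ge> \<phi> (\<lambda>_. 1)" for zs
  proof (induction zs)
    case (Cons s zs)
    have s: "s \<in> I" "s \<in> S" and zI: "set zs \<subseteq> I" and zS: "set zs \<subseteq> S"
      using Cons.prems I by auto
    have red: "length zs = len (lp zs)" and up: "len (lp zs) < len (s \<otimes> lp zs)"
      using Cons.prems(2) len_le[OF zS] len_left[OF s(2) lp_S[OF zS]] by auto
    let ?f = "play zs (\<lambda>_. 1)"
    have pos: "?f s > 0" using play_pos[OF zS s(2) up] by simp
    have "\<phi> (fire s ?f) = \<phi> ?f + (\<Sum>r\<in>I. n r * game_coeff s r) * ?f s"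
      by (simp add: \<phi>_def fire_def sum_distrib_right sum.distrib distrib_left mult.assoc)
    then have "\<phi> (fire s ?f) \<ge> \<phi> ?f" using sub[OF s(1)] pos by simp
    then show ?case using Cons.IH[OF zI red] by simp
  qed simp
  then have "\<phi> (play xs (\<lambda>_. 1)) \<ge> \<phi> (\<lambda>_. 1)" using xs by simp
  moreover have "\<phi> (\<lambda>_. 1) > 0"
    using n I(2) unfolding \<phi>_def by (intro sum_pos2[of _ i]) auto
  moreover have "\<phi> (play xs (\<lambda>_. 1)) \<le> 0"
  proof -
    have "play xs (\<lambda>_. 1) r < 0" if "r \<in> I" for r
      using play_neg[of xs r "\<lambda>_. 1"] xs w(2) that I by auto
    then show ?thesis unfolding \<phi>_def using n(1) by (intro sum_nonpos) (auto simp: mult_nonneg_nonpos less_imp_le)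
  qed
  ultimately show False by simp
qed

section \<open>The shape of the diagram when parabolic subgroups are finite\<close>

abbreviation "diagram \<equiv> coxeter_diagram S m"

lemma diagram_iff: "(s, t) \<in> diagram \<longleftrightarrow> s \<in> S \<and> t \<in> S \<and> s \<noteq> t \<and> 3 \<le> m s t"
  by (auto simp: coxeter_diagram_def)

lemma diagram_sym: "(s, t) \<in> diagram \<Longrightarrow> (t, s) \<in> diagram"
  by (auto simp: diagram_iff matrix_sym)

lemma matrix_nonadjacent:
  assumes "s \<in> S" "t \<in> S" "s \<noteq> t" "(s, t) \<notin> diagram" shows "m s t = enat 2"
proof -
  have "2 \<le> m s t" "\<not> 3 \<le> m s t" using assms matrix_ge2 by (auto simp: diagram_iff)
  then show ?thesis by (cases "m s t") (auto simp: numeral_eq_enat)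
qed

lemma nonadjacent_commute:
  assumes "s \<in> S" "t \<in> S" "(s, t) \<notin> diagram" shows "s \<otimes> t = t \<otimes> s"
proof (cases "s = t")
  case False
  then show ?thesis using braid[OF assms(1,2) matrix_nonadjacent] assms by (simp add: numeral_2_eq_2)
qed simp

lemma game_coeff_nonadjacent:
  assumes "s \<in> S" "t \<in> S" "s \<noteq> t" "(s, t) \<notin> diagram" shows "game_coeff s t = 0"
  using matrix_nonadjacent[OF assms] assms by (simp add: game_coeff_def)

lemma game_coeff_adjacent:
  assumes "(s, t) \<in> diagram" shows "game_coeff s t \<ge> 1"
proof (cases "m s t")
  case (enat k)
  then have k: "k \<ge> 3" using assms by (auto simp: diagram_iff numeral_eq_enat)
  then have "pi / real k \<le> pi / 3" by (intro divide_left_mono) auto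
  then have "cos (pi / 3) \<le> cos (pi / real k)" by (intro cos_monotone_0_pi_le) auto
  then show ?thesis using assms enat by (simp add: game_coeff_def diagram_iff cos_60)
qed (use assms in \<open>simp add: game_coeff_def diagram_iff\<close>)

lemma game_coeff_nonneg:
  assumes "s \<in> S" "t \<in> S" "s \<noteq> t" shows "game_coeff s t \<ge> 0"
  using game_coeff_adjacent[of s t] game_coeff_nonadjacent[OF assms] by (cases "(s, t) \<in> diagram") auto

text \<open>If every vertex had two neighbours in \<open>I\<close>, constant weights would violate
  the criterion: each row sum is at least -2 + 1 + 1. Applied to all subsets of the generators, this
  makes the diagram a forest.\<close>

lemma leaf_exists:
  assumes I: "I \<subseteq> S" "finite I" "I \<noteq> {}" and fin: "finite (para I)"
  shows "\<exists>s\<in>I. card {r\<in>I. (s, r) \<in> diagram} \<le> 1"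
proof (rule ccontr)
  assume neg: "\<not> ?thesis"
  obtain i where i: "i \<in> I" using I by blast
  have "(\<Sum>r\<in>I. 1 * game_coeff s r) \<ge> 0" if s: "s \<in> I" for s
  proof -
    let ?N = "{r\<in>I. (s, r) \<in> diagram}"
    have "card ?N \<ge> 2" using neg s by force
    have "(\<Sum>r\<in>I. game_coeff s r) = game_coeff s s + (\<Sum>r\<in>I - {s}. game_coeff s r)"
      using s I by (simp add: sum.remove)
    moreover have "(\<Sum>r\<in>I - {s}. game_coeff s r) \<ge> (\<Sum>r\<in>?N. game_coeff s r)"
      using I s by (intro sum_mono2) (auto simp: diagram_iff intro!: game_coeff_nonneg)
    moreover have "(\<Sum>r\<in>?N. game_coeff s r) \<ge> (\<Sum>r\<in>?N. 1)"
      by (intro sum_mono) (auto intro: game_coeff_adjacent)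
    ultimately show ?thesis using \<open>card ?N \<ge> 2\<close> by simp
  qed
  then show False by (intro no_subinvariant_weights[OF I(1,2) fin, of "\<lambda>_. 1" i]) (use i in auto)
qed

lemma degree_le_3:
  assumes fin: "\<And>I. I \<subseteq> S \<Longrightarrow> finite I \<Longrightarrow> finite (para I)"
  shows "finite {r. (v, r) \<in> diagram} \<and> card {r. (v, r) \<in> diagram} \<le> 3"
proof (rule ccontr)
  assume neg: "\<not> ?thesis"
  obtain T where T: "T \<subseteq> {r. (v, r) \<in> diagram}" "finite T" "card T = 4"
  proof (cases "finite {r. (v, r) \<in> diagram}")
    case True
    then have "4 \<le> card {r. (v, r) \<in> diagram}" using neg by simp
    then show thesis using that obtain_subset_with_card_n by metis
  next
    case False
    then show thesis using that infinite_arbitrarily_large by metis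
  qed
  have vT: "v \<notin> T" and TS: "T \<subseteq> S" using T by (auto simp: diagram_iff)
  have "T \<noteq> {}" using T by auto
  then have vS: "v \<in> S" using T by (auto simp: diagram_iff)
  \<comment> \<open>The null vector of the affine diagram D4: centre 2, leaves 1. Heavier bonds and
    edges between leaves only raise the sums.\<close>
  define n where "n r = (if r = v then 2 else 1 :: real)" for r
  have n1: "n r = 1" if "r \<in> T" for r using that vT by (auto simp: n_def)
  have "(\<Sum>r\<in>insert v T. n r * game_coeff s r) \<ge> 0" if s: "s \<in> insert v T" for s
  proof -
    have e: "(\<Sum>r\<in>insert v T. n r * game_coeff s r) = 2 * game_coeff s v + (\<Sum>r\<in>T. game_coeff s r)"
      using vT T(2) n1 by (simp add: n_def[of v])
    show ?thesis
    proof (cases "s = v")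
      case True
      have "(\<Sum>r\<in>T. game_coeff s r) \<ge> (\<Sum>r\<in>T. 1)"
        using T True by (intro sum_mono) (auto intro: game_coeff_adjacent)
      then show ?thesis using True T e by simp
    next
      case False
      then have sT: "s \<in> T" using s by simp
      then have "(v, s) \<in> diagram" using T by auto
      then have a: "game_coeff s v \<ge> 1" using game_coeff_adjacent diagram_sym by blast
      have "(\<Sum>r\<in>T. game_coeff s r) = - 2 + (\<Sum>r\<in>T - {s}. game_coeff s r)"
        using sT T(2) by (simp add: sum.remove)
      moreover have "(\<Sum>r\<in>T - {s}. game_coeff s r) \<ge> 0"
        using TS sT by (intro sum_nonneg game_coeff_nonneg) auto
      ultimately show ?thesis using a e by simp
    qed
  qed
  moreover have "insert v T \<subseteq> S" "finite (insert v T)" using vS TS T by auto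
  ultimately show False
    by (intro no_subinvariant_weights[of "insert v T" n v] fin) (auto simp: n_def)
qed

end

section \<open>A positive eigenvector\<close>

text \<open>First-order condition at a maximum. For \<open>e = p / ?d\<close> the right-hand side is
  at most half the left-hand side.\<close>

lemma linear_term_zero:
  fixes p c :: real
  assumes "\<And>e. 2 * e * p \<le> e\<^sup>2 * c" shows "p = 0"
proof (rule ccontr)
  assume p: "p \<noteq> 0"
  let ?d = "\<bar>c\<bar> + 1"
  have "2 * (p / ?d) * p \<le> (p / ?d)\<^sup>2 * c" by (rule assms)
  also have "\<dots> \<le> (p / ?d)\<^sup>2 * ?d" by (intro mult_left_mono) auto
  also have "\<dots> = (p / ?d) * p" by (simp add: power2_eq_square)
  finally have "p / ?d * p \<le> 0" by simp
  moreover have "p / ?d * p > 0" using p by (auto intro!: divide_pos_pos simp: zero_less_mult_iff)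
  ultimately show False by simp
qed

text \<open>The eigenvector is a maximizer of the quadratic form on the nonnegative part of the unit sphere; since replacing
  all entries by their absolute values does not decrease the form, it is a maximizer on the whole
  sphere, hence an eigenvector.\<close>

lemma positive_eigenvector:
  fixes a :: "'i \<Rightarrow> 'i \<Rightarrow> real"
  assumes I: "finite I" "I \<noteq> {}"
    and sym: "\<And>s t. s \<in> I \<Longrightarrow> t \<in> I \<Longrightarrow> a s t = a t s"
    and nonneg: "\<And>s t. s \<in> I \<Longrightarrow> t \<in> I \<Longrightarrow> a s t \<ge> 0"
    and conn: "\<And>s t. s \<in> I \<Longrightarrow> t \<in> I \<Longrightarrow> (s, t) \<in> {(s, t). s \<in> I \<and> t \<in> I \<and> a s t > 0}\<^sup>*"
  obtains v \<rho> where "\<And>s. s \<in> I \<Longrightarrow> v s > 0" "\<And>s. s \<in> I \<Longrightarrow> (\<Sum>t\<in>I. a s t * v t) = \<rho> * v s"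
proof -
  define Q where "Q x = (\<Sum>s\<in>I. \<Sum>t\<in>I. a s t * x s * x t)" for x :: "'i \<Rightarrow> real"
  define N where "N x = (\<Sum>s\<in>I. (x s)\<^sup>2)" for x :: "'i \<Rightarrow> real"
  \<comment> \<open>Coordinates off \<open>I\<close> are pinned to 0, so the box is compact in the
    product topology on all functions.\<close>
  define C where "C = PiE UNIV (\<lambda>i. if i \<in> I then {0..1::real} else {0})"
  define K where "K = C \<inter> {x. N x = 1}"
  have "compactin (product_topology (\<lambda>i. euclidean) UNIV) C"
    unfolding C_def by (subst compactin_PiE) auto
  then have "compact C" by (simp add: euclidean_product_topology)
  moreover have "closed {x. N x = 1}"
    unfolding N_def by (intro closed_Collect_eq continuous_intros continuous_on_product_coordinates)
  ultimately have "compact K" unfolding K_def by (rule compact_Int_closed)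
  moreover have "K \<noteq> {}"
  proof -
    obtain i where i: "i \<in> I" using I by blast
    have "N (\<lambda>r. if r = i then 1 else 0) = 1"
      using i I by (simp add: N_def power2_eq_square if_distrib[of "\<lambda>x. x * _"] cong: if_cong)
    then have "(\<lambda>r. if r = i then 1 else 0) \<in> K" using i by (auto simp: K_def C_def)
    then show ?thesis by blast
  qed
  moreover have "continuous_on K Q"
    unfolding Q_def by (intro continuous_intros continuous_on_subset[OF continuous_on_product_coordinates]) auto
  ultimately obtain v where v: "v \<in> K" and max: "\<And>x. x \<in> K \<Longrightarrow> Q x \<le> Q v"
    using continuous_attains_sup[of K Q] by blast
  define \<rho> where "\<rho> = Q v"
  have v0: "v s \<ge> 0" if "s \<in> I" for s using v that by (auto simp: K_def C_def PiE_iff split: if_splits)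
  have vN: "N v = 1" using v by (simp add: K_def)
  have scale: "Q (\<lambda>r. c * x r) = c\<^sup>2 * Q x" for c x
    by (simp add: Q_def sum_distrib_left power2_eq_square mult_ac)
  have abs: "Q x \<le> Q (\<lambda>r. \<bar>x r\<bar>)" for x
  proof -
    have "a s t * x s * x t \<le> a s t * \<bar>x s\<bar> * \<bar>x t\<bar>" if "s \<in> I" "t \<in> I" for s t
      using nonneg[OF that] by (metis abs_ge_self abs_mult mult.assoc mult_left_mono)
    then show ?thesis unfolding Q_def by (intro sum_mono)
  qed
  have Qcong: "Q x = Q y" if "\<And>r. r \<in> I \<Longrightarrow> x r = y r" for x y
    using that unfolding Q_def by (intro sum.cong) auto
  have bound: "Q x \<le> \<rho> * N x" for x
  proof (cases "N x = 0")
    case True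
    then have "\<forall>s\<in>I. x s = 0" using I by (simp add: N_def sum_nonneg_eq_0_iff)
    then have "Q x = 0" by (simp add: Q_def)
    then show ?thesis using True by simp
  next
    case False
    have "N x \<ge> 0" unfolding N_def by (intro sum_nonneg) auto
    then have Np: "N x > 0" using False by simp
    let ?c = "1 / sqrt (N x)"
    let ?y = "\<lambda>r. if r \<in> I then ?c * \<bar>x r\<bar> else 0"
    have c2: "?c\<^sup>2 = 1 / N x" using Np by (simp add: power_divide)
    have "N ?y = (\<Sum>s\<in>I. ?c\<^sup>2 * (x s)\<^sup>2)" unfolding N_def by (intro sum.cong) (auto simp: power_divide)
    also have "\<dots> = ?c\<^sup>2 * N x" by (simp add: N_def sum_distrib_left)
    finally have Ny: "N ?y = 1" using c2 Np by simp
    have "(?y s)\<^sup>2 \<le> 1" if "s \<in> I" for s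
    proof -
      have "(?y s)\<^sup>2 \<le> N ?y" unfolding N_def using I(1) that by (intro member_le_sum) auto
      then show ?thesis using Ny by simp
    qed
    then have "?y s \<le> 1" if "s \<in> I" for s using that by (metis abs_le_square_iff abs_one one_power2 abs_ge_self order_trans)
    moreover have "?y s \<ge> 0" for s using Np by simp
    ultimately have "?y \<in> C" using Np unfolding C_def by (auto simp: PiE_iff)
    then have "Q ?y \<le> \<rho>" using max Ny by (simp add: K_def \<rho>_def)
    moreover have "Q ?y = ?c\<^sup>2 * Q (\<lambda>r. \<bar>x r\<bar>)"
      unfolding scale[symmetric] by (rule Qcong) simp
    ultimately have "Q (\<lambda>r. \<bar>x r\<bar>) \<le> \<rho> * N x" using c2 Np by (simp add: field_simps)
    then show ?thesis using abs[of x] by simp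
  qed
  have eig: "(\<Sum>t\<in>I. a s t * v t) = \<rho> * v s" if s: "s \<in> I" for s
  proof -
    let ?A = "\<lambda>r. \<Sum>t\<in>I. a r t * v t"
    \<comment> \<open>Perturb coordinate \<open>s\<close> by \<open>e\<close> and compare
      \<open>Q\<close> with \<open>\<rho> * N\<close>; the terms of order zero agree because
      \<open>v\<close> attains the maximum.\<close>
    have "2 * e * (?A s - \<rho> * v s) \<le> e\<^sup>2 * (\<rho> - a s s)" for e
    proof -
      let ?d = "\<lambda>r. if r = s then e else 0"
      let ?x = "\<lambda>r. v r + ?d r"
      have "N ?x = (\<Sum>r\<in>I. (v r)\<^sup>2 + (if r = s then 2 * e * v r + e\<^sup>2 else 0))"
        unfolding N_def by (intro sum.cong) (auto simp: power2_eq_square algebra_simps)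
      also have "\<dots> = N v + 2 * e * v s + e\<^sup>2"
        using s I(1) by (simp add: sum.distrib N_def)
      finally have Nx: "N ?x = 1 + 2 * e * v s + e\<^sup>2" using vN by simp
      have inner: "(\<Sum>t\<in>I. a r t * ?x t) = ?A r + a r s * e" for r
      proof -
        have "(\<Sum>t\<in>I. a r t * ?x t) = (\<Sum>t\<in>I. a r t * v t + (if t = s then a r s * e else 0))"
          by (intro sum.cong) (auto simp: distrib_left)
        then show ?thesis using s I(1) by (simp add: sum.distrib)
      qed
      have "Q ?x = (\<Sum>r\<in>I. ?x r * (\<Sum>t\<in>I. a r t * ?x t))"
        unfolding Q_def by (simp only: sum_distrib_left mult_ac)
      also have "\<dots> = (\<Sum>r\<in>I. v r * ?A r + e * (a r s * v r) + (if r = s then e * ?A r + e\<^sup>2 * a r s else 0))"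
        unfolding inner by (intro sum.cong) (auto simp: power2_eq_square algebra_simps)
      also have "\<dots> = (\<Sum>r\<in>I. v r * ?A r) + e * (\<Sum>r\<in>I. a r s * v r) + (e * ?A s + e\<^sup>2 * a s s)"
        using s I(1) by (simp add: sum.distrib sum_distrib_left)
      also have "(\<Sum>r\<in>I. v r * ?A r) = \<rho>"
        unfolding \<rho>_def Q_def by (simp only: sum_distrib_left mult_ac)
      also have "(\<Sum>r\<in>I. a r s * v r) = ?A s"
        using sym s by (intro sum.cong) auto
      finally have "Q ?x = \<rho> + 2 * e * ?A s + e\<^sup>2 * a s s" by simp
      then show ?thesis using bound[of ?x] Nx by (simp add: algebra_simps)
    qed
    then have "?A s - \<rho> * v s = 0" by (rule linear_term_zero)
    then show ?thesis by simp
  qed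
  \<comment> \<open>At a zero of \<open>v\<close> the eigenvalue equation is a vanishing sum of
    nonnegative terms, so zeros spread along edges.\<close>
  have zero: "v t = 0" if "s \<in> I" "t \<in> I" "a s t > 0" "v s = 0" for s t
  proof -
    have "(\<Sum>t\<in>I. a s t * v t) = 0" using eig[OF that(1)] that by simp
    then have "\<forall>t\<in>I. a s t * v t = 0"
      using I(1) nonneg[OF that(1)] v0 by (subst (asm) sum_nonneg_eq_0_iff) auto
    then show ?thesis using that by auto
  qed
  have pos: "v s > 0" if s: "s \<in> I" for s
  proof (rule ccontr)
    assume "\<not> v s > 0"
    then have s0: "v s = 0" using v0[OF s] by simp
    have "v t = 0" if "t \<in> I" for t
      using conn[OF s that] by (induction rule: rtrancl_induct) (use s0 zero in auto)
    then have "N v = 0" by (simp add: N_def)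
    then show False using vN by simp
  qed
  show thesis using that[of v \<rho>] pos eig by blast
qed

context coxeter begin

section \<open>Conjugacy of Coxeter elements of a forest\<close>

text \<open>Moves that preserve the conjugacy class of the product: a rotation conjugates by a
  prefix, a swap changes nothing. Keeping words instead of elements allows induction on the
  letters.\<close>

inductive conj_words :: "'a list \<Rightarrow> 'a list \<Rightarrow> bool" for xs where
  refl: "conj_words xs xs"
| rotate: "conj_words xs (a @ b) \<Longrightarrow> conj_words xs (b @ a)"
| swap: "conj_words xs (a @ s # t # b) \<Longrightarrow> (s, t) \<notin> diagram \<Longrightarrow> conj_words xs (a @ t # s # b)"

lemma conj_words_trans: "conj_words ys zs \<Longrightarrow> conj_words xs ys \<Longrightarrow> conj_words xs zs"
proof (induction rule: conj_words.induct)
  case (rotate a b)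
  show ?case by (rule conj_words.rotate[OF rotate.IH[OF rotate.prems]])
next
  case (swap a s t b)
  show ?case by (rule conj_words.swap[OF swap.IH[OF swap.prems] swap.hyps(2)])
qed

lemma conj_words_sym: "conj_words xs ys \<Longrightarrow> conj_words ys xs"
proof (induction rule: conj_words.induct)
  case (rotate a b)
  have "conj_words (b @ a) (a @ b)" by (rule conj_words.rotate[OF conj_words.refl])
  then show ?case by (rule conj_words_trans[OF rotate.IH])
next
  case (swap a s t b)
  have "conj_words (a @ t # s # b) (a @ s # t # b)"
    using swap.hyps diagram_sym by (intro conj_words.swap[OF conj_words.refl]) blast
  then show ?case by (rule conj_words_trans[OF swap.IH])
qed (rule conj_words.refl)

lemma conj_words_set: "conj_words xs ys \<Longrightarrow> set ys = set xs \<and> (distinct ys \<longleftrightarrow> distinct xs)"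
  by (induction rule: conj_words.induct) auto

lemma conj_words_move:
  "\<forall>r\<in>set a. (v, r) \<notin> diagram \<Longrightarrow> conj_words (p @ v # a @ q) (p @ a @ v # q)"
proof (induction a arbitrary: p)
  case (Cons r a)
  have "conj_words (p @ v # r # a @ q) (p @ r # v # a @ q)"
    using Cons.prems by (intro conj_words.swap[OF conj_words.refl]) auto
  moreover have "conj_words ((p @ [r]) @ v # a @ q) ((p @ [r]) @ a @ v # q)"
    using Cons.prems by (intro Cons.IH) simp
  ultimately show ?case using conj_words_trans[of "p @ r # v # a @ q"] by simp
qed (simp add: conj_words.refl)

text \<open>A rotation of the other letters has to be imitated with \<open>v\<close> in front.
  Having at most one neighbour, \<open>v\<close> commutes with all of \<open>a\<close> or with all
  of \<open>b\<close> and can be carried past that part.\<close>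

lemma conj_words_Cons:
  assumes "conj_words xs ys" "distinct xs" "card {r \<in> set xs. (v, r) \<in> diagram} \<le> 1"
  shows "conj_words (v # xs) (v # ys)"
  using assms
proof (induction rule: conj_words.induct)
  case refl
  show ?case by (rule conj_words.refl)
next
  case (swap a s t b)
  then have "conj_words (v # xs) ((v # a) @ s # t # b)" by simp
  then show ?case using conj_words.swap swap.hyps(2) by fastforce
next
  case (rotate a b)
  have ab: "set xs = set a \<union> set b" "set a \<inter> set b = {}"
    using conj_words_set[OF rotate.hyps] rotate.prems by auto
  have "(\<forall>r\<in>set a. (v, r) \<notin> diagram) \<or> (\<forall>r\<in>set b. (v, r) \<notin> diagram)"
  proof (rule ccontr)
    assume "\<not> ?thesis"
    then obtain r r' where "r \<in> set a" "r' \<in> set b" "(v, r) \<in> diagram" "(v, r') \<in> diagram" by blast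
    then have "{r, r'} \<subseteq> {r \<in> set xs. (v, r) \<in> diagram}" "r \<noteq> r'" using ab by auto
    then have "2 \<le> card {r \<in> set xs. (v, r) \<in> diagram}"
      by (metis (no_types, lifting) List.finite_set card_2_iff card_mono finite_subset mem_Collect_eq subsetI)
    then show False using rotate.prems by simp
  qed
  then have "conj_words (v # a @ b) (v # b @ a)"
  proof
    assume "\<forall>r\<in>set a. (v, r) \<notin> diagram"
    then have "conj_words (v # a @ b) (a @ v # b)" using conj_words_move[of a v "[]" b] by simp
    then have "conj_words (v # a @ b) ((v # b) @ a)" by (rule conj_words.rotate)
    then show ?thesis by simp
  next
    assume b: "\<forall>r\<in>set b. (v, r) \<notin> diagram"
    have "conj_words ((v # a) @ b) (b @ (v # a))" by (rule conj_words.rotate[OF conj_words.refl])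
    moreover have "conj_words (b @ v # a) (v # b @ a)"
      using conj_words_sym[OF conj_words_move[OF b, of "[]" a]] by simp
    ultimately show ?thesis using conj_words_trans[of "b @ v # a"] by simp
  qed
  moreover have "conj_words (v # xs) (v # a @ b)" using rotate by simp
  ultimately show ?case by (rule conj_words_trans)
qed

text \<open>Rotate a leaf to the front of both words, treat the rest by induction, and restore the
  leaf by \<open>conj_words_Cons\<close>.\<close>

lemma conj_words_forest:
  assumes "finite I" "\<And>J. J \<subseteq> I \<Longrightarrow> J \<noteq> {} \<Longrightarrow> \<exists>s\<in>J. card {r\<in>J. (s, r) \<in> diagram} \<le> 1"
    and "distinct xs" "set xs = I" "distinct ys" "set ys = I"
  shows "conj_words xs ys"
  using assms
proof (induction "card I" arbitrary: I xs ys)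
  case 0
  then show ?case by (simp add: conj_words.refl)
next
  case (Suc n)
  then have "I \<noteq> {}" by auto
  then obtain v where v: "v \<in> I" "card {r\<in>I. (v, r) \<in> diagram} \<le> 1" using Suc.prems(2) by blast
  obtain a b where xs: "xs = a @ v # b" using v Suc.prems by (metis split_list)
  obtain c d where ys: "ys = c @ v # d" using v Suc.prems by (metis split_list)
  have x: "conj_words xs (v # b @ a)"
    unfolding xs using conj_words.rotate[of "a @ v # b" a "v # b"] conj_words.refl by simp
  have y: "conj_words ys (v # d @ c)"
    unfolding ys using conj_words.rotate[of "c @ v # d" c "v # d"] conj_words.refl by simp
  have s: "set (b @ a) = I - {v}" "distinct (b @ a)" "set (d @ c) = I - {v}" "distinct (d @ c)"
    using Suc.prems xs ys by auto
  have "conj_words (b @ a) (d @ c)"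
  proof (rule Suc.hyps(1)[OF _ _ _ s(2,1,4,3)])
    show "n = card (I - {v})" "finite (I - {v})" using Suc.prems(1) Suc.hyps(2) v by auto
    show "\<exists>s\<in>J. card {r \<in> J. (s, r) \<in> diagram} \<le> 1" if "J \<subseteq> I - {v}" "J \<noteq> {}" for J
      using that by (intro Suc.prems(2)) auto
  qed
  moreover have "card {r \<in> set (b @ a). (v, r) \<in> diagram} \<le> card {r\<in>I. (v, r) \<in> diagram}"
    using s Suc.prems(1) by (intro card_mono) auto
  ultimately have "conj_words (v # b @ a) (v # d @ c)"
    using v(2) s(2) by (intro conj_words_Cons) linarith+
  then have "conj_words xs (v # d @ c)" using x by (rule conj_words_trans)
  then show ?case by (rule conj_words_trans[OF conj_words_sym[OF y]])
qed

lemma conj_words_conj: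
  assumes "conj_words xs ys" "set xs \<subseteq> S"
  shows "\<exists>g\<in>carrier W. lp ys = g \<otimes> lp xs \<otimes> inv g"
  using assms
proof (induction rule: conj_words.induct)
  case refl
  then show ?case by (intro bexI[of _ \<one>]) auto
next
  case (rotate a b)
  have ab: "set a \<subseteq> S" "set b \<subseteq> S" using conj_words_set[OF rotate.hyps] rotate.prems by auto
  obtain g where g: "g \<in> carrier W" "lp (a @ b) = g \<otimes> lp xs \<otimes> inv g" using rotate by blast
  have "lp (b @ a) = inv (lp a) \<otimes> lp (a @ b) \<otimes> lp a"
    using ab by (simp add: lp_append_S flip: m_assoc)
  also have "\<dots> = (inv (lp a) \<otimes> g) \<otimes> lp xs \<otimes> inv (inv (lp a) \<otimes> g)"
    unfolding g(2) using ab g(1) rotate.prems by (simp add: m_assoc inv_mult_group)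
  finally show ?case using ab g(1) by (intro bexI[of _ "inv (lp a) \<otimes> g"]) auto
next
  case (swap a s t b)
  have ab: "set a \<subseteq> S" "set b \<subseteq> S" "s \<in> S" "t \<in> S"
    using conj_words_set[OF swap.hyps(1)] swap.prems by auto
  have "s \<otimes> (t \<otimes> lp b) = t \<otimes> (s \<otimes> lp b)"
    using nonadjacent_commute[OF ab(3,4) swap.hyps(2)] ab by (simp flip: m_assoc)
  then have "lp (a @ s # t # b) = lp (a @ t # s # b)"
    using ab by (simp add: lp_append_S)
  then show ?case using swap by simp
qed

lemma pow_conj:
  "g \<in> carrier W \<Longrightarrow> x \<in> carrier W \<Longrightarrow> (g \<otimes> x \<otimes> inv g) [^] (n::nat) = g \<otimes> x [^] n \<otimes> inv g"
proof (induction n)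
  case (Suc n)
  have "inv g \<otimes> (g \<otimes> (x \<otimes> inv g)) = x \<otimes> inv g"
    using Suc.prems by (simp flip: m_assoc)
  then show ?case using Suc by (simp add: m_assoc)
qed simp

lemma ord_conj:
  assumes g: "g \<in> carrier W" and x: "x \<in> carrier W"
  shows "ord (g \<otimes> x \<otimes> inv g) = ord x"
proof -
  have "g \<otimes> y \<otimes> inv g = \<one> \<longleftrightarrow> y = \<one>" if "y \<in> carrier W" for y
    using conj_eq_iff[of "inv g" y \<one>] g that by simp
  then have "(g \<otimes> x \<otimes> inv g) [^] n = \<one> \<longleftrightarrow> x [^] n = \<one>" for n :: nat
    using g x by (simp add: pow_conj)
  then have "ord (g \<otimes> x \<otimes> inv g) dvd n \<longleftrightarrow> ord x dvd n" for n
    using g x by (simp flip: pow_eq_id)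
  then show ?thesis by (meson dvd_antisym dvd_refl)
qed

text \<open>Partition the diagram without a leaf; the leaf then fits on a side that misses its only
  possible neighbour.\<close>

lemma bipartition_exists:
  assumes "finite I" "\<And>J. J \<subseteq> I \<Longrightarrow> J \<noteq> {} \<Longrightarrow> \<exists>s\<in>J. card {r\<in>J. (s, r) \<in> diagram} \<le> 1"
  shows "\<exists>L R. L \<union> R = I \<and> L \<inter> R = {} \<and> (\<forall>s\<in>L. \<forall>t\<in>L. (s, t) \<notin> diagram) \<and> (\<forall>s\<in>R. \<forall>t\<in>R. (s, t) \<notin> diagram)"
  using assms
proof (induction "card I" arbitrary: I)
  case (Suc n)
  then have "I \<noteq> {}" by auto
  then obtain v where v: "v \<in> I" "card {r\<in>I. (v, r) \<in> diagram} \<le> 1" using Suc.prems(2) by blast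
  have "\<exists>L R. L \<union> R = I - {v} \<and> L \<inter> R = {} \<and> (\<forall>s\<in>L. \<forall>t\<in>L. (s, t) \<notin> diagram) \<and> (\<forall>s\<in>R. \<forall>t\<in>R. (s, t) \<notin> diagram)"
  proof (rule Suc.hyps(1))
    show "n = card (I - {v})" "finite (I - {v})" using Suc.prems Suc.hyps(2) v by auto
    show "\<exists>s\<in>J. card {r \<in> J. (s, r) \<in> diagram} \<le> 1" if "J \<subseteq> I - {v}" "J \<noteq> {}" for J
      using that by (intro Suc.prems(2)) auto
  qed
  then obtain L R where LR: "L \<union> R = I - {v}" "L \<inter> R = {}"
    "\<forall>s\<in>L. \<forall>t\<in>L. (s, t) \<notin> diagram" "\<forall>s\<in>R. \<forall>t\<in>R. (s, t) \<notin> diagram" by blast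
  have vv: "(v, v) \<notin> diagram" by (simp add: diagram_iff)
  have "(\<forall>r\<in>L. (v, r) \<notin> diagram) \<or> (\<forall>r\<in>R. (v, r) \<notin> diagram)"
  proof (rule ccontr)
    assume "\<not> ?thesis"
    then obtain r r' where "r \<in> L" "r' \<in> R" "(v, r) \<in> diagram" "(v, r') \<in> diagram" by blast
    then have "{r, r'} \<subseteq> {r \<in> I. (v, r) \<in> diagram}" "r \<noteq> r'" using LR by blast+
    then have "{r, r'} \<subseteq> {r \<in> I. (v, r) \<in> diagram}" "card {r, r'} = 2" by auto
    then have "2 \<le> card {r \<in> I. (v, r) \<in> diagram}"
      using card_mono[of "{r \<in> I. (v, r) \<in> diagram}" "{r, r'}"] Suc.prems(1) by simp
    then show False using v by simp
  qed
  then show ?case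
  proof
    assume a: "\<forall>r\<in>L. (v, r) \<notin> diagram"
    then have "\<forall>r\<in>L. (r, v) \<notin> diagram" using diagram_sym by blast
    then show ?thesis using a LR v vv by (intro exI[of _ "insert v L"] exI[of _ R]) auto
  next
    assume a: "\<forall>r\<in>R. (v, r) \<notin> diagram"
    then have "\<forall>r\<in>R. (r, v) \<notin> diagram" using diagram_sym by blast
    then show ?thesis using a LR v vv by (intro exI[of _ L] exI[of _ "insert v R"]) auto
  qed
qed simp

section \<open>The bipartite numbers game\<close>

text \<open>By \<open>para_descent\<close>, a new letter cannot be a descent of the product of the
  earlier ones.\<close>

lemma len_distinct: "set zs \<subseteq> S \<Longrightarrow> distinct zs \<Longrightarrow> len (lp zs) = length zs"
proof (induction zs rule: rev_induct)
  case (snoc s zs)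
  then have z: "set zs \<subseteq> S" "s \<in> S" "s \<notin> set zs" by auto
  have "\<not> len (lp zs \<otimes> s) < len (lp zs)"
    using para_descent[OF z(1) lp_para[OF subset_refl] z(2)] z(3) by blast
  then have "len (lp zs \<otimes> s) = len (lp zs) + 1" using len_right[OF z(2), of "lp zs"] z by auto
  then show ?case using snoc z by (simp add: lp_append_S)
qed simp

text \<open>Pairwise nonadjacent vertices do not influence one another, so their moves amount to a
  single simultaneous move.\<close>

lemma play_independent:
  assumes "set zs \<subseteq> S" "distinct zs" "\<forall>s\<in>set zs. \<forall>t\<in>set zs. (s, t) \<notin> diagram" "r \<in> S"
  shows "play zs f r = (if r \<in> set zs then - f r else f r + (\<Sum>z\<in>set zs. game_coeff z r * f z))"
  using assms
proof (induction zs arbitrary: r)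
  case (Cons s zs)
  have sz: "s \<notin> set zs" "s \<in> S" and coeff: "game_coeff z s = 0" if "z \<in> set zs" for z
    using Cons.prems that by (auto intro!: game_coeff_nonadjacent)
  have c0: "game_coeff s z = 0" if "z \<in> set zs" for z
    using Cons.prems that by (auto intro!: game_coeff_nonadjacent)
  have s: "s \<notin> set zs" "s \<in> S" using Cons.prems by auto
  have IH: "play zs f r = (if r \<in> set zs then - f r else f r + (\<Sum>z\<in>set zs. game_coeff z r * f z))"
    if "r \<in> S" for r using Cons.prems Cons.IH that by simp
  have fs: "play zs f s = f s" using IH[OF s(2)] s(1) coeff by simp
  show ?case
    using IH[OF Cons.prems(4)] s c0 by (auto simp: fire_def fs)
qed simp

fun bipartite_word :: "'a list \<Rightarrow> 'a list \<Rightarrow> nat \<Rightarrow> 'a list" where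
  "bipartite_word A B 0 = []"
| "bipartite_word A B (Suc n) = bipartite_word A B n @ (if even n then A else B)"

lemma bipartite_word_add:
  "bipartite_word A B (n + k) = bipartite_word A B n @ (if even n then bipartite_word A B k else bipartite_word B A k)"
  by (induction k) auto

lemma set_bipartite_word: "set (bipartite_word A B n) \<subseteq> set A \<union> set B"
  by (induction n) auto

lemma length_bipartite_word_mono:
  "n \<le> k \<Longrightarrow> length (bipartite_word A B n) \<le> length (bipartite_word A B k)"
  by (induction k rule: dec_induct) auto

lemma length_bipartite_word_Suc2:
  "length (bipartite_word A B (Suc (Suc n))) = length (bipartite_word A B n) + length A + length B"
  by (cases "even n") auto

lemma length_bipartite_word_strict:
  assumes "n + 2 \<le> k" "A \<noteq> [] \<or> B \<noteq> []"
  shows "length (bipartite_word A B n) < length (bipartite_word A B k)"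
proof -
  have "length A > 0 \<or> length B > 0" using assms(2) by simp
  then show ?thesis
    using length_bipartite_word_Suc2[of A B n] length_bipartite_word_mono[of "Suc (Suc n)" k A B] assms(1)
    by linarith
qed

end

text \<open>From index 1 on (index 0 only starts the recursion), the values fired in the bipartite game
  that begins with the positive eigenvector of eigenvalue \<open>\<rho>\<close>, in units of that vector; they are \<open>sin (n \<theta> - \<theta> / 2) / sin (\<theta> / 2)\<close> for \<open>\<rho> = 2 cos \<theta>\<close>.\<close>

fun fired :: "real \<Rightarrow> nat \<Rightarrow> real" where
  "fired \<rho> 0 = - 1"
| "fired \<rho> (Suc 0) = 1"
| "fired \<rho> (Suc (Suc n)) = \<rho> * fired \<rho> (Suc n) - fired \<rho> n"

text \<open>The assumptions are symmetric in the two blocks, so each result also holds for words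
  starting with \<open>B\<close>. A block may be empty, as happens in rank one.\<close>

locale bipartite_coxeter = coxeter W S m for W :: "('a, 'b) monoid_scheme" (structure) and S m +
  fixes A B :: "'a list" and v :: "'a \<Rightarrow> real" and \<rho> :: real
  assumes AB: "set A \<union> set B = S" "distinct A" "distinct B" "set A \<inter> set B = {}"
    and indep: "\<forall>s\<in>set A. \<forall>t\<in>set A. (s, t) \<notin> coxeter_diagram S m"
      "\<forall>s\<in>set B. \<forall>t\<in>set B. (s, t) \<notin> coxeter_diagram S m"
    and nonempty: "S \<noteq> {}"
    and v_pos: "\<And>s. s \<in> S \<Longrightarrow> v s > 0"
    and eigen: "\<And>s. s \<in> S \<Longrightarrow> (\<Sum>t\<in>S. (if s = t then 0 else game_coeff s t) * v t) = \<rho> * v s"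
begin

lemma swapped: "bipartite_coxeter W S m B A v \<rho>"
  using bipartite_coxeter_axioms by (auto simp: bipartite_coxeter_def bipartite_coxeter_axioms_def)

abbreviation "word \<equiv> bipartite_word A B"
abbreviation "turn n \<equiv> (if even n then A else B)"
abbreviation "other n \<equiv> (if even n then B else A)"

lemma turn_sub: "set (turn n) \<subseteq> S" "set (other n) \<subseteq> S" "set (turn n) \<union> set (other n) = S"
  using AB by auto

lemma set_word: "set (word n) \<subseteq> S"
  using set_bipartite_word AB by blast

lemma finite_S: "finite S"
  using AB by (metis List.finite_set finite_Un)

lemma neighbour_sum:
  assumes "r \<in> set (other n)"
  shows "(\<Sum>z\<in>set (turn n). game_coeff z r * v z) = \<rho> * v r"
proof -
  have r: "r \<in> S" "r \<notin> set (turn n)" using assms AB by (auto split: if_splits)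
  have "(\<Sum>z\<in>set (turn n). game_coeff z r * v z) = (\<Sum>z\<in>set (turn n). (if r = z then 0 else game_coeff r z) * v z)"
  proof (rule sum.cong)
    fix z assume z: "z \<in> set (turn n)"
    then have "z \<in> S" "r \<noteq> z" using r turn_sub(1)[of n] by auto
    then show "game_coeff z r * v z = (if r = z then 0 else game_coeff r z) * v z"
      using game_coeff_sym[OF r(1)] by simp
  qed simp
  also have "\<dots> = (\<Sum>z\<in>S. (if r = z then 0 else game_coeff r z) * v z)"
  proof (rule sum.mono_neutral_left[OF finite_S turn_sub(1)], rule ballI)
    fix z assume "z \<in> S - set (turn n)"
    then have "z \<in> set (other n)" using turn_sub by blast
    then have "(r, z) \<notin> diagram" using indep assms by (cases "even n") auto
    then have "r \<noteq> z \<Longrightarrow> game_coeff r z = 0"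
      using r \<open>z \<in> S - _\<close> by (intro game_coeff_nonadjacent) auto
    then show "(if r = z then 0 else game_coeff r z) * v z = 0" by simp
  qed
  finally show ?thesis using eigen[OF r(1)] by simp
qed

text \<open>Firing a block negates it and, by the eigenvector equation, adds \<open>\<rho>\<close>
  times the fired multiple to the other block. This is the recursion of \<open>fired\<close>; its
  value -1 at index 0 matches the unfired start.\<close>

lemma play_word:
  "(\<forall>r\<in>set (turn n). play (rev (word n)) v r = fired \<rho> (Suc n) * v r) \<and>
   (\<forall>r\<in>set (other n). play (rev (word n)) v r = - fired \<rho> n * v r)"
proof (induction n)
  case (Suc n)
  let ?f = "play (rev (word n)) v"
  have z: "set (rev (turn n)) \<subseteq> S" "distinct (rev (turn n))"
    "\<forall>s\<in>set (rev (turn n)). \<forall>t\<in>set (rev (turn n)). (s, t) \<notin> diagram"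
    using AB indep by auto
  have e: "play (rev (word (Suc n))) v = play (rev (turn n)) ?f" by (simp add: play_append)
  have 1: "play (rev (word (Suc n))) v r = - fired \<rho> (Suc n) * v r" if r: "r \<in> set (turn n)" for r
  proof -
    have "r \<in> S" using r turn_sub by blast
    then show ?thesis unfolding e using play_independent[OF z, of r ?f] r Suc by simp
  qed
  have 2: "play (rev (word (Suc n))) v r = fired \<rho> (Suc (Suc n)) * v r" if r: "r \<in> set (other n)" for r
  proof -
    have rS: "r \<in> S" "r \<notin> set (turn n)" using r AB by (auto split: if_splits)
    have "(\<Sum>z\<in>set (turn n). game_coeff z r * ?f z) = (\<Sum>z\<in>set (turn n). fired \<rho> (Suc n) * (game_coeff z r * v z))"
      using Suc by (intro sum.cong) (auto split: if_splits)
    also have "\<dots> = fired \<rho> (Suc n) * (\<rho> * v r)"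
      using neighbour_sum[OF r] by (simp flip: sum_distrib_left)
    finally have "play (rev (turn n)) ?f r = ?f r + fired \<rho> (Suc n) * (\<rho> * v r)"
      using play_independent[OF z rS(1), of ?f] rS(2) by simp
    then show ?thesis unfolding e using Suc r by (simp add: algebra_simps)
  qed
  show ?case using 1 2 by (cases "even n") auto
qed simp

lemma lp_word_Suc: "lp (word (Suc n)) = lp (word n) \<otimes> lp (turn n)"
  unfolding bipartite_word.simps by (rule lp_append_S[OF set_word turn_sub(1)])

text \<open>Reversal passes to the inverse element and so turns right descents into left ones, the
  kind that the game detects.\<close>

lemma descent_word_iff:
  assumes "s \<in> S"
  shows "len (lp (word n) \<otimes> s) < len (lp (word n)) \<longleftrightarrow> play (rev (word n)) v s < 0"
    and "len (lp (word n)) < len (lp (word n) \<otimes> s) \<longleftrightarrow> play (rev (word n)) v s > 0"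
    and "play (rev (word n)) v s \<noteq> 0"
  using descent_iff_play[of "rev (word n)" s v] set_word[of n] assms v_pos
  by (auto simp: lp_rev len_right_inv)

lemma descent_turn: "s \<in> set (turn n) \<Longrightarrow> len (lp (word n) \<otimes> s) < len (lp (word n)) \<longleftrightarrow> fired \<rho> (Suc n) < 0"
  and ascent_turn: "s \<in> set (turn n) \<Longrightarrow> len (lp (word n)) < len (lp (word n) \<otimes> s) \<longleftrightarrow> fired \<rho> (Suc n) > 0"
  and descent_other: "s \<in> set (other n) \<Longrightarrow> len (lp (word n) \<otimes> s) < len (lp (word n)) \<longleftrightarrow> fired \<rho> n > 0"
proof -
  show "len (lp (word n) \<otimes> s) < len (lp (word n)) \<longleftrightarrow> fired \<rho> (Suc n) < 0"
    "len (lp (word n)) < len (lp (word n) \<otimes> s) \<longleftrightarrow> fired \<rho> (Suc n) > 0" if s: "s \<in> set (turn n)"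
  proof -
    have sS: "s \<in> S" using s turn_sub by blast
    have "play (rev (word n)) v s = fired \<rho> (Suc n) * v s" using play_word s by blast
    then show "len (lp (word n) \<otimes> s) < len (lp (word n)) \<longleftrightarrow> fired \<rho> (Suc n) < 0"
      "len (lp (word n)) < len (lp (word n) \<otimes> s) \<longleftrightarrow> fired \<rho> (Suc n) > 0"
      using descent_word_iff[OF sS, of n] v_pos[OF sS] by (auto simp: mult_less_0_iff zero_less_mult_iff)
  qed
  show "len (lp (word n) \<otimes> s) < len (lp (word n)) \<longleftrightarrow> fired \<rho> n > 0" if s: "s \<in> set (other n)"
  proof -
    have sS: "s \<in> S" using s turn_sub by blast
    have "play (rev (word n)) v s = - fired \<rho> n * v s" using play_word s by blast
    then show ?thesis
      using descent_word_iff[OF sS, of n] v_pos[OF sS] by (auto simp: mult_less_0_iff zero_less_mult_iff)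
  qed
qed

lemma fired_nonzero_turn: "turn n \<noteq> [] \<Longrightarrow> fired \<rho> (Suc n) \<noteq> 0"
proof
  assume "turn n \<noteq> []" and f: "fired \<rho> (Suc n) = 0"
  then obtain s where s: "s \<in> set (turn n)" using list.set_sel(1) by blast
  then have "play (rev (word n)) v s = 0" using play_word[of n] f by simp
  moreover have "s \<in> S" using s turn_sub by blast
  ultimately show False using descent_word_iff(3) by blast
qed

text \<open>An empty block has no vertex at which to read the value; the game started with
  \<open>B\<close> then has one, with the same sequence, which depends on \<open>\<rho>\<close>
  only.\<close>

lemma fired_nonzero: "fired \<rho> (Suc n) \<noteq> 0"
proof (cases "turn n = []")
  case True
  then have "other n \<noteq> []" using turn_sub(3)[of n] nonempty by auto
  then show ?thesis using bipartite_coxeter.fired_nonzero_turn[OF swapped, of n] by simp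
qed (rule fired_nonzero_turn)

lemma len_word: "\<forall>i<n. fired \<rho> (Suc i) > 0 \<Longrightarrow> len (lp (word n)) = length (word n)"
proof (induction n)
  case (Suc n)
  have "len (lp (word n) \<otimes> lp (turn n)) = len (lp (word n)) + len (lp (turn n))"
    using ascent_turn[of _ n] Suc.prems set_word turn_sub
    by (intro minimal_additive[OF turn_sub(1)]) (auto intro: lp_para)
  moreover have "len (lp (turn n)) = length (turn n)"
    using AB turn_sub by (intro len_distinct) auto
  ultimately show ?case using Suc lp_word_Suc[of n] by simp
qed simp

text \<open>The number of blocks after which the word can no longer be prolonged. Only
  \<open>\<rho>\<close> enters, so starting with \<open>B\<close> gives the same number.\<close>

definition cox_num :: nat where "cox_num = (LEAST n. fired \<rho> (Suc n) < 0)"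

lemma length_word_ge: "n \<le> length (word (2 * n))"
proof (induction n)
  case (Suc n)
  have "length A + length B \<noteq> 0" using AB nonempty by auto
  then have "length A + length B \<ge> 1" by linarith
  then show ?case using Suc length_bipartite_word_Suc2[of A B "2 * n"] by simp
qed simp

context
  assumes finite_W: "finite (carrier W)"
begin

text \<open>Otherwise all alternating words would be reduced, while lengths in a finite group are
  bounded.\<close>

lemma fired_negative: "\<exists>n. fired \<rho> (Suc n) < 0"
proof (rule ccontr)
  assume "\<not> ?thesis"
  then have "fired \<rho> (Suc i) > 0" for i using fired_nonzero[of i] by (metis linorder_neqE_linordered_idom)
  then have l: "len (lp (word n)) = length (word n)" for n by (intro len_word) auto
  let ?M = "Max (len ` carrier W)"
  have "len (lp (word (2 * Suc ?M))) \<le> ?M" using finite_W lp_S[OF set_word] by (intro Max_ge) (blast intro: imageI)+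
  then show False using l[of "2 * Suc ?M"] length_word_ge[of "Suc ?M"] by linarith
qed

lemma fired_cox_num: "fired \<rho> (Suc cox_num) < 0"
  unfolding cox_num_def by (rule LeastI_ex[OF fired_negative])

lemma fired_pos: "i < cox_num \<Longrightarrow> fired \<rho> (Suc i) > 0"
  using not_less_Least[of i "\<lambda>n. fired \<rho> (Suc n) < 0"] fired_nonzero[of i]
  by (auto simp: cox_num_def not_less)

lemma cox_num_pos: "cox_num > 0"
  using fired_cox_num by (cases cox_num) auto

lemma len_word_le: "n \<le> cox_num \<Longrightarrow> len (lp (word n)) = length (word n)"
  by (intro len_word) (auto intro: fired_pos)

text \<open>The block due next is negative by the choice of \<open>cox_num\<close>; the block before
  it is negative because it was fired from positive values.\<close>

lemma desc_longest: "desc (lp (word cox_num)) = S"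
proof -
  have "fired \<rho> cox_num > 0" using fired_pos[of "cox_num - 1"] cox_num_pos by simp
  then have "len (lp (word cox_num) \<otimes> s) < len (lp (word cox_num))" if "s \<in> S" for s
    using that descent_turn[of s cox_num] descent_other[of s cox_num] fired_cox_num turn_sub(3)[of cox_num]
    by blast
  then show ?thesis by (auto simp: desc_iff)
qed

lemma longest_descent: "s \<in> S \<Longrightarrow> len (lp (word cox_num) \<otimes> s) < len (lp (word cox_num))"
  using desc_longest by (auto simp: desc_iff)

end

text \<open>Outside the previous context finiteness is an explicit premise of its lemmas, so they
  can be applied with the blocks exchanged.\<close>

context
  assumes finite_W: "finite (carrier W)"
begin

lemma word_swap: "lp (bipartite_word B A cox_num) = lp (word cox_num)"
proof (rule longest_unique[OF subset_refl])
  show "len (lp (bipartite_word B A cox_num) \<otimes> s) < len (lp (bipartite_word B A cox_num))" if "s \<in> S" for s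
    using bipartite_coxeter.longest_descent[OF swapped finite_W that] .
  show "lp (bipartite_word B A cox_num) \<in> para S"
    using bipartite_coxeter.set_word[OF swapped] by (rule lp_para)
qed (use longest_descent[OF finite_W] set_word in \<open>auto intro: lp_para\<close>)

lemma longest_sq: "lp (word cox_num) \<otimes> lp (word cox_num) = \<one>"
proof -
  let ?w = "lp (word cox_num)"
  have "len (?w \<otimes> ?w) + len ?w = len ?w"
    using longest_descent[OF finite_W] set_word by (intro len_mult_longest_right[OF subset_refl]) (auto intro: lp_para)
  then show ?thesis using len_eq_0[of "?w \<otimes> ?w"] set_word by simp
qed

lemma AB_pow: "lp (A @ B) [^] i = lp (word (2 * i))"
proof (induction i)
  case (Suc i)
  have "lp (word (2 * Suc i)) = lp (word (2 * i)) \<otimes> lp (A @ B)"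
    using lp_append_S[OF set_word, of "A @ B" "2 * i"] AB by auto
  then show ?case using Suc by simp
qed simp

text \<open>The power \<open>cox_num\<close> has \<open>2 * cox_num\<close> blocks, that is, it is
  the longest element squared. A smaller trivial power would be a nonempty reduced word, or would
  leave a word for the longest element that is too short.\<close>

lemma ord_AB: "ord (lp (A @ B)) = cox_num"
proof -
  let ?c = "lp (A @ B)"
  have c: "?c \<in> carrier W" using AB by simp
  have swap_sub: "set (bipartite_word B A n) \<subseteq> S" for n by (rule bipartite_coxeter.set_word[OF swapped])
  have "lp (word (2 * cox_num)) = lp (word cox_num) \<otimes> lp (if even cox_num then word cox_num else bipartite_word B A cox_num)"
    unfolding mult_2 bipartite_word_add using set_word swap_sub by (intro lp_append_S) auto
  then have "?c [^] cox_num = \<one>" using AB_pow word_swap longest_sq by (simp split: if_splits)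
  then have dvd: "ord ?c dvd cox_num" using c pow_eq_id by blast
  then have le: "ord ?c \<le> cox_num" "ord ?c > 0"
    using cox_num_pos[OF finite_W] dvd_imp_le by (auto intro!: Nat.gr0I)
  have "\<not> ord ?c < cox_num"
  proof
    let ?i = "ord ?c"
    assume lt: "?i < cox_num"
    have one: "lp (word (2 * ?i)) = \<one>" using c AB_pow[of ?i] by simp
    show False
    proof (cases "2 * ?i \<le> cox_num")
      case True
      then show False using len_word_le[OF finite_W True] one length_word_ge[of ?i] le by simp
    next
      case False
      let ?j = "2 * ?i - cox_num"
      \<comment> \<open>A gap of two blocks makes the length strictly smaller even if
        \<open>A\<close> or \<open>B\<close> is empty.\<close>
      have j: "2 * ?i = cox_num + ?j" "?j + 2 \<le> cox_num" using False lt by auto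
      let ?u = "if even cox_num then word ?j else bipartite_word B A ?j"
      let ?v = "if even cox_num then word cox_num else bipartite_word B A cox_num"
      have u: "set ?u \<subseteq> S" using set_word swap_sub by simp
      have "lp (word cox_num) \<otimes> lp ?u = \<one>"
        using one lp_append_S[OF set_word u, of cox_num] bipartite_word_add[of A B cox_num ?j] j(1) by simp
      then have "lp ?u = lp (word cox_num)"
        using longest_sq u set_word by (metis l_cancel lp_S)
      also have "\<dots> = lp ?v" using word_swap by simp
      finally have "len (lp ?u) = len (lp ?v)" by simp
      moreover have "len (lp ?u) = length ?u" "len (lp ?v) = length ?v"
        using len_word_le[OF finite_W] bipartite_coxeter.len_word_le[OF swapped finite_W] j by auto
      moreover have "length ?u < length ?v"
      proof -
        have "A \<noteq> [] \<or> B \<noteq> []" using AB nonempty by auto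
        then show ?thesis
          using length_bipartite_word_strict[OF j(2), of A B] length_bipartite_word_strict[OF j(2), of B A]
          by (cases "even cox_num") auto
      qed
      ultimately show False by simp
    qed
  qed
  then show ?thesis using le by simp
qed

lemma commuting_turn: "a \<in> set (turn n) \<Longrightarrow> b \<in> set (turn n) \<Longrightarrow> a \<otimes> b = b \<otimes> a"
  using indep turn_sub(1)[of n] by (intro nonadjacent_commute) (auto split: if_splits)

lemma pop_funpow_subword:
  assumes w: "w \<in> carrier W"
  shows "k \<le> cox_num \<Longrightarrow> (pop ^^ k) w \<in> subword_set (word (cox_num - k))"
proof (induction k)
  case 0
  show ?case using subword_longest[OF set_word desc_longest[OF finite_W] w] by simp
next
  case (Suc k)
  let ?n = "cox_num - Suc k"
  have "cox_num - k = Suc ?n" using Suc.prems by simp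
  then have mem: "(pop ^^ k) w \<in> subword_set (word ?n @ turn ?n)" using Suc by simp
  have "pop ((pop ^^ k) w) \<in> subword_set (word ?n)"
    by (rule subword_pop[OF set_word turn_sub(1) _ mem]) (rule commuting_turn)
  then show ?case by simp
qed

text \<open>After \<open>cox_num\<close> steps \<open>pop_funpow_subword\<close> alone gives the
  identity, but this allows orbits of size \<open>cox_num + 1\<close>. Stopping one block earlier
  and using both starting blocks saves a step.\<close>

lemma pop_funpow_cox_num:
  assumes w: "w \<in> carrier W" shows "(pop ^^ (cox_num - 1)) w = \<one>"
proof (rule ccontr)
  let ?x = "(pop ^^ (cox_num - 1)) w"
  assume ne: "?x \<noteq> \<one>"
  have 1: "cox_num - (cox_num - 1) = Suc 0" using cox_num_pos[OF finite_W] by simp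
  have "?x \<in> subword_set A"
    using pop_funpow_subword[OF w, of "cox_num - 1"] unfolding 1 by simp
  then have xA: "?x \<in> para (set A)" using subword_para by blast
  have "?x \<in> subword_set B"
    using bipartite_coxeter.pop_funpow_subword[OF swapped finite_W w, of "cox_num - 1"] unfolding 1 by simp
  then have xB: "?x \<in> para (set B)" using subword_para by blast
  have sub: "set A \<subseteq> S" "set B \<subseteq> S" using AB by auto
  obtain s where s: "s \<in> set A" "len (?x \<otimes> s) < len ?x"
    using right_descent_exists[OF sub(1) xA ne] by blast
  then have "s \<in> set B" using para_descent[OF sub(2) xB] sub by blast
  then show False using s AB by blast
qed

text \<open>Short of the longest element, the descents are exactly the last block. At
  \<open>Suc n = cox_num\<close> all generators are descents, so the inequality has to be
  strict.\<close>

lemma pop_word: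
  assumes n: "Suc n < cox_num" shows "pop (lp (word (Suc n))) = lp (word n)"
proof -
  have pos: "fired \<rho> (Suc n) > 0" "fired \<rho> (Suc (Suc n)) > 0"
    using fired_pos[OF finite_W, of n] fired_pos[OF finite_W n] n by linarith+
  have d: "desc (lp (word n) \<otimes> lp (turn n)) = set (turn n)"
  proof -
    have "s \<in> desc (lp (word (Suc n))) \<longleftrightarrow> s \<in> set (turn n)" for s
    proof (cases "s \<in> S")
      case True
      show ?thesis
      proof (cases "s \<in> set (turn n)")
        case t: True
        then have "s \<in> set (other (Suc n))" by (cases "even n") auto
        then show ?thesis using True t descent_other[of s "Suc n"] pos(1) unfolding desc_iff by blast
      next
        case False
        then have "s \<in> set (turn (Suc n))" using True turn_sub(3)[of n] by (cases "even n") auto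
        then show ?thesis using False descent_turn[of s "Suc n"] pos(2) unfolding desc_iff by (meson not_less_iff_gr_or_eq)
      qed
    qed (use turn_sub(1)[of n] in \<open>auto simp: desc_iff\<close>)
    then show ?thesis unfolding lp_word_Suc[symmetric] by blast
  qed
  have "pop (lp (word n) \<otimes> lp (turn n)) = lp (word n)"
  proof (rule pop_eqI)
    show "lp (word n) \<in> carrier W" by (rule lp_S[OF set_word])
    show "lp (turn n) \<in> para (desc (lp (word n) \<otimes> lp (turn n)))"
      unfolding d by (rule lp_para[OF subset_refl])
    show "len (lp (word n)) < len (lp (word n) \<otimes> s)"
      if "s \<in> desc (lp (word n) \<otimes> lp (turn n))" for s
      using that ascent_turn[of s n] pos unfolding d by blast
  qed
  then show ?thesis by (simp only: lp_word_Suc)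
qed

lemma pop_funpow_word: "k \<le> n \<Longrightarrow> n < cox_num \<Longrightarrow> (pop ^^ k) (lp (word n)) = lp (word (n - k))"
proof (induction k)
  case (Suc k)
  have "n - k = Suc (n - Suc k)" using Suc.prems by simp
  then have "pop (lp (word (n - k))) = lp (word (n - Suc k))"
    using pop_word[of "n - Suc k"] Suc.prems by simp
  then show ?case using Suc by simp
qed simp

lemma sup_orbit:
  assumes A: "A \<noteq> []"
  shows "(SUP w \<in> carrier W. ecard (forward_orbit pop w)) = enat cox_num"
proof (rule antisym)
  have h: "Suc (cox_num - 1) = cox_num" using cox_num_pos[OF finite_W] by simp
  show "(SUP w \<in> carrier W. ecard (forward_orbit pop w)) \<le> enat cox_num"
    using orbit_le[OF pop_funpow_cox_num] h by (intro SUP_least) metis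
  let ?w = "lp (word (cox_num - 1))"
  have w: "?w \<in> carrier W" by (rule lp_S[OF set_word])
  have "(pop ^^ j) ?w \<noteq> \<one>" if j: "j < cox_num - 1" for j
  proof
    let ?k = "cox_num - 1 - j"
    assume "(pop ^^ j) ?w = \<one>"
    then have "lp (word ?k) = \<one>" using pop_funpow_word[of j "cox_num - 1"] j by simp
    then have "length (word ?k) = 0" using len_word_le[OF finite_W, of ?k] by simp
    \<comment> \<open>At least one block is left, and the first block \<open>A\<close> is nonempty
      by assumption.\<close>
    moreover have "length (word 1) \<le> length (word ?k)"
      using j by (intro length_bipartite_word_mono) simp
    ultimately show False using A by simp
  qed
  then have "enat cox_num \<le> ecard (forward_orbit pop ?w)"
    using orbit_ge[OF w, of "cox_num - 1"] h by simp
  then show "enat cox_num \<le> (SUP w \<in> carrier W. ecard (forward_orbit pop w))"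
    by (rule SUP_upper2[OF w])
qed

end
end

context coxeter begin

lemma diagram_coeff_pos:
  "(s, t) \<in> diagram \<Longrightarrow> s \<in> S \<and> t \<in> S \<and> (if s = t then 0 else game_coeff s t) > 0"
  using game_coeff_adjacent[of s t] by (auto simp: diagram_iff)

theorem sup_orbit_finite:
  assumes irr: "coxeter_irreducible S m" and fin: "finite (carrier W)" and c: "coxeter_element W S c"
  shows "(SUP w \<in> carrier W. ecard (forward_orbit pop w)) = enat (ord c)"
\<comment> \<open>Without vertices there is no eigenvector; here the only Coxeter element is the
  identity, whose order 1 is the size of the only orbit.\<close>
proof (cases "S = {}")
  case True
  obtain xs where xs: "set xs = S" "c = lp xs" using c by (auto simp: coxeter_element_def)
  have "c = \<one>" using xs True by simp
  moreover have "carrier W = {\<one>}"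
    unfolding carrier_para True by (auto simp: parabolic_def)
  moreover have "forward_orbit pop \<one> = {\<one>}"
    using orbit_eq[of 0 \<one>] by simp
  moreover have "ord \<one> = 1" using ord_eq_1[of \<one>] by simp
  ultimately show ?thesis by (simp add: ecard_def one_enat_def)
next
  case False
  have finS: "finite S" using fin S_carrier by (rule rev_finite_subset)
  have fp: "finite (para J)" if "J \<subseteq> S" for J
    using fin para_closed[OF that] by (meson finite_subset subsetI)
  have leaf: "\<exists>s\<in>J. card {r\<in>J. (s, r) \<in> diagram} \<le> 1" if "J \<subseteq> S" "J \<noteq> {}" for J
    using leaf_exists[OF that(1) _ that(2) fp[OF that(1)]] finite_subset[OF that(1) finS] by blast
  obtain L R where LR: "L \<union> R = S" "L \<inter> R = {}" "\<forall>s\<in>L. \<forall>t\<in>L. (s, t) \<notin> diagram"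
    "\<forall>s\<in>R. \<forall>t\<in>R. (s, t) \<notin> diagram" "L \<noteq> {}"
  proof -
    obtain L R where LR: "L \<union> R = S" "L \<inter> R = {}" "\<forall>s\<in>L. \<forall>t\<in>L. (s, t) \<notin> diagram"
      "\<forall>s\<in>R. \<forall>t\<in>R. (s, t) \<notin> diagram"
      using bipartition_exists[OF finS leaf] by blast
    show thesis
    proof (cases "L = {}")
      case True
      then show thesis using that[of R L] LR False by auto
    qed (use that[of L R] LR in auto)
  qed
  obtain A where A: "set A = L" "distinct A" using LR(1) finS finite_distinct_list by (metis finite_Un)
  obtain B where B: "set B = R" "distinct B" using LR(1) finS finite_distinct_list by (metis finite_Un)
  let ?a = "\<lambda>s t. if s = t then 0 else game_coeff s t"
  have conn: "(s, t) \<in> {(s, t). s \<in> S \<and> t \<in> S \<and> ?a s t > 0}\<^sup>*" if "s \<in> S" "t \<in> S" for s t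
  proof -
    have "(s, t) \<in> diagram\<^sup>*" using irr that by (auto simp: coxeter_irreducible_def)
    moreover have "diagram \<subseteq> {(s, t). s \<in> S \<and> t \<in> S \<and> ?a s t > 0}"
    proof
      fix p assume p: "p \<in> diagram"
      then show "p \<in> {(s, t). s \<in> S \<and> t \<in> S \<and> ?a s t > 0}"
        using diagram_coeff_pos[of "fst p" "snd p"] by (simp add: case_prod_unfold)
    qed
    ultimately show ?thesis using rtrancl_mono by blast
  qed
  obtain v \<rho> where v: "\<And>s. s \<in> S \<Longrightarrow> v s > (0::real)" "\<And>s. s \<in> S \<Longrightarrow> (\<Sum>t\<in>S. ?a s t * v t) = \<rho> * v s"
  proof (rule positive_eigenvector[of S ?a])
    show "?a s t = ?a t s" if "s \<in> S" "t \<in> S" for s t using game_coeff_sym that by simp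
    show "?a s t \<ge> 0" if "s \<in> S" "t \<in> S" for s t using game_coeff_nonneg that by simp
    show "(s, t) \<in> {(s, t). s \<in> S \<and> t \<in> S \<and> ?a s t > 0}\<^sup>*" if "s \<in> S" "t \<in> S" for s t
      by (rule conn[OF that])
  qed (use finS False in auto)
  interpret bipartite_coxeter W S m A B v \<rho>
    using LR A B v False by unfold_locales auto
  obtain xs where xs: "distinct xs" "set xs = S" "c = lp xs" using c by (auto simp: coxeter_element_def)
  have "conj_words (A @ B) xs"
    using A B LR xs by (intro conj_words_forest[OF finS leaf]) auto
  then obtain g where "g \<in> carrier W" "c = g \<otimes> lp (A @ B) \<otimes> inv g"
    using conj_words_conj[of "A @ B" xs] A B LR xs by auto
  then have "ord c = ord (lp (A @ B))" using ord_conj A B LR by simp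
  then have "ord c = cox_num" using ord_AB[OF fin] by simp
  then show ?thesis using sup_orbit[OF fin] A LR(5) by auto
qed

section \<open>Infinite Coxeter groups\<close>

lemma len_unbounded:
  assumes I: "I \<subseteq> S" "finite I" and inf: "infinite (para I)"
  shows "\<exists>w\<in>para I. len w > n"
proof (rule ccontr)
  assume neg: "\<not> ?thesis"
  have "para I \<subseteq> lp ` {xs. set xs \<subseteq> I \<and> length xs \<le> n}"
  proof
    fix w assume w: "w \<in> para I"
    obtain xs where "set xs \<subseteq> I" "lp xs = w" "length xs = len w" by (rule para_reduced[OF I(1) w])
    then show "w \<in> lp ` {xs. set xs \<subseteq> I \<and> length xs \<le> n}" using neg w by force
  qed
  then show False using finite_lists_length_le[OF I(2)] inf by (meson finite_imageI finite_subset)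
qed

text \<open>On a parabolic subgroup with finitely many generators, one step of \<open>pop\<close> removes the longest
  element of a finite parabolic subgroup, and there are only finitely many of these.\<close>

lemma pop_bounded_decrease:
  assumes I: "I \<subseteq> S" "finite I"
  obtains M where "\<forall>w\<in>para I. pop w \<in> para I \<and> len w \<le> len (pop w) + M"
proof -
  define lng where "lng J = {u \<in> para J. \<forall>s\<in>J. len (u \<otimes> s) < len u}" for J
  have "finite (lng J)" if "J \<in> Pow I" for J
  proof -
    have "J \<subseteq> S" using that I by auto
    then have "\<forall>u\<in>lng J. \<forall>v\<in>lng J. u = v"
      using longest_unique by (simp add: lng_def)
    then have "lng J \<subseteq> {u}" if "u \<in> lng J" for u using that by blast
    then show ?thesis by (metis finite.emptyI finite.insertI finite_subset subsetI empty_iff)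
  qed
  then have "finite (\<Union>J\<in>Pow I. lng J)" using I(2) by blast
  then obtain M where M: "\<forall>u\<in>(\<Union>J\<in>Pow I. lng J). len u \<le> M"
    by (metis finite_nat_set_iff_bounded_le finite_imageI imageI)
  have "pop w \<in> para I \<and> len w \<le> len (pop w) + M" if w: "w \<in> para I" for w
  proof -
    have wc: "w \<in> carrier W" using para_closed[OF I(1) w] .
    have J: "desc w \<subseteq> I" using para_descent[OF I(1) w] by (auto simp: desc_iff)
    obtain u where u: "pop w \<in> carrier W" "u \<in> para (desc w)" "w = pop w \<otimes> u"
      "\<forall>v\<in>para (desc w). len (pop w \<otimes> v) = len (pop w) + len v"
      "\<forall>s\<in>desc w. len (u \<otimes> s) < len u"
      by (rule pop_decomposition[OF wc])
    have "len u \<le> M" using M J u by (auto simp: lng_def)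
    moreover have "len w = len (pop w) + len u" using u by metis
    moreover have uI: "u \<in> para I" using u(2) para_mono[OF J] by blast
    moreover have "w \<otimes> inv u = pop w \<otimes> (u \<otimes> inv u)"
      using u(1,3) para_closed[OF I(1) uI] by (metis inv_closed m_assoc)
    then have "w \<otimes> inv u = pop w" using u(1) para_closed[OF I(1) uI] by simp
    then have "pop w \<in> para I" using para_mult[OF I(1) w para_inv[OF I(1) uI]] by simp
    ultimately show ?thesis by simp
  qed
  then show thesis using that by blast
qed

lemma orbit_infinite_para:
  assumes I: "I \<subseteq> S" "finite I" and inf: "infinite (para I)"
  shows "\<exists>w\<in>carrier W. \<forall>j<n. (pop ^^ j) w \<noteq> \<one>"
proof -
  obtain M where M: "\<forall>w\<in>para I. pop w \<in> para I \<and> len w \<le> len (pop w) + M"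
    by (rule pop_bounded_decrease[OF I])
  have *: "(pop ^^ j) w \<in> para I \<and> len w \<le> len ((pop ^^ j) w) + j * M" if "w \<in> para I" for w j
  proof (induction j)
    case (Suc j)
    then have "pop ((pop ^^ j) w) \<in> para I \<and> len ((pop ^^ j) w) \<le> len (pop ((pop ^^ j) w)) + M"
      using M by blast
    then show ?case using Suc by simp
  qed (use that in simp)
  obtain w where w: "w \<in> para I" "len w > n * M" using len_unbounded[OF assms] by blast
  have "(pop ^^ j) w \<noteq> \<one>" if "j < n" for j
  proof
    assume "(pop ^^ j) w = \<one>"
    then have "len w \<le> j * M" using *[OF w(1), of j] by simp
    also have "\<dots> \<le> n * M" using that by simp
    finally show False using w by simp
  qed
  then show ?thesis using w para_closed[OF I(1)] by blast
qed

text \<open>From the constant position 1, each letter of the path fires a larger amount than its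
  predecessor did, which makes the predecessor positive again. So only the last letter fired is
  negative. Edges off the path can only raise values.\<close>

lemma play_path:
  assumes path: "\<And>i. i < k \<Longrightarrow> (f i, f (Suc i)) \<in> diagram" "inj_on f {..k}"
  shows "j \<le> k \<Longrightarrow> (let g = play (rev (map f [0..<j])) (\<lambda>_. 1) in
    (\<forall>r\<in>S. r \<notin> f ` {..<j} \<longrightarrow> g r \<ge> 1) \<and>
    (\<forall>i. Suc i < j \<longrightarrow> g (f i) > 0) \<and>
    (0 < j \<longrightarrow> g (f (j - 1)) < 0 \<and> g (f j) \<ge> 1 - g (f (j - 1))))"
proof (induction j)
  case 0
  show ?case by simp
next
  case (Suc j)
  define g where "g = play (rev (map f [0..<j])) (\<lambda>_. 1)"
  have jk: "j < k" using Suc.prems by simp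
  have fS: "f i \<in> S" if "i \<le> k" for i
    using path(1)[of i] path(1)[of "i - 1"] that jk by (cases "i < k") (auto simp: diagram_iff)
  have inj: "f a \<noteq> f b" if "a \<le> k" "b \<le> k" "a \<noteq> b" for a b
    using path(2) that by (auto simp: inj_on_def)
  have IH1: "g r \<ge> 1" if "r \<in> S" "r \<notin> f ` {..<j}" for r
    using Suc that by (simp add: g_def Let_def)
  have IH2: "g (f i) > 0" if "Suc i < j" for i
    using Suc that by (simp add: g_def Let_def)
  have IH3: "g (f (j - 1)) < 0" "g (f j) \<ge> 1 - g (f (j - 1))" if "0 < j"
    using Suc that by (simp_all add: g_def Let_def)
  have fresh: "f b \<notin> f ` {..<j}" if b: "j \<le> b" "b \<le> k" for b
  proof
    assume "f b \<in> f ` {..<j}"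
    then obtain i where "i < j" "f b = f i" by auto
    then show False using inj[of i b] b by simp
  qed
  have gj: "g (f j) \<ge> 1" using IH1[of "f j"] fS[of j] fresh[of j] jk by simp
  let ?h = "play (rev (map f [0..<Suc j])) (\<lambda>_. 1)"
  have h: "?h = fire (f j) g" by (simp add: g_def)
  have inc: "?h r \<ge> g r" if "r \<in> S" "r \<noteq> f j" for r
    using game_coeff_nonneg[of "f j" r] fS[of j] that gj jk unfolding h by (simp add: fire_def)
  have nb: "?h r \<ge> g r + g (f j)" if "(f j, r) \<in> diagram" for r
    using mult_right_mono[OF game_coeff_adjacent[OF that], of "g (f j)"] gj unfolding h by (simp add: fire_def)
  have "?h r \<ge> 1" if "r \<in> S" "r \<notin> f ` {..<Suc j}" for r
  proof -
    have "r \<noteq> f j" "r \<notin> f ` {..<j}" using that(2) by auto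
    then show ?thesis using inc[of r] IH1[of r] that(1) by linarith
  qed
  moreover have "?h (f i) > 0" if "Suc i < Suc j" for i
  proof (cases "Suc i = j")
    case True
    have "(f j, f i) \<in> diagram" using path(1)[of i] True jk diagram_sym by auto
    moreover have "i = j - 1" "0 < j" using True by auto
    ultimately show ?thesis using nb[of "f i"] IH3 by auto
  next
    case False
    then have "Suc i < j" using that by simp
    then show ?thesis using inc[of "f i"] IH2[of i] fS[of i] inj[of i j] jk by fastforce
  qed
  moreover have hj: "?h (f j) = - g (f j)" unfolding h by simp
  moreover have "?h (f (Suc j)) \<ge> 1 + g (f j)"
  proof -
    have "f (Suc j) \<notin> f ` {..<j}" using fresh[of "Suc j"] jk by simp
    then show ?thesis using nb[of "f (Suc j)"] path(1)[OF jk] IH1[of "f (Suc j)"] fS[of "Suc j"] jk by auto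
  qed
  ultimately show ?case using gj by (simp only: Let_def) auto
qed

lemma orbit_path:
  assumes path: "\<And>i. i < k \<Longrightarrow> (f i, f (Suc i)) \<in> diagram" "inj_on f {..k}"
  shows "\<exists>w\<in>carrier W. \<forall>j<k. (pop ^^ j) w \<noteq> \<one>"
proof -
  \<comment> \<open>The path has \<open>k + 1\<close> vertices and the word stops at the first
    \<open>k\<close>: \<open>play_path\<close> also speaks about the successor of the last letter
    fired.\<close>
  define p where "p j = lp (map f [0..<j])" for j
  have fS: "f i \<in> S" if "i < k" for i using path(1)[OF that] by (simp add: diagram_iff)
  have sub: "set (map f [0..<j]) \<subseteq> S" if "j \<le> k" for j using fS that by auto
  have pc: "p j \<in> carrier W" if "j \<le> k" for j unfolding p_def by (rule lp_S[OF sub[OF that]])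
  have pS: "p (Suc j) = p j \<otimes> f j" if "j < k" for j
    using sub[of j] fS[OF that] that by (simp add: p_def lp_append_S)
  have desc: "desc (p (Suc j)) = {f j}" if j: "j < k" for j
  proof -
    let ?xs = "rev (map f [0..<Suc j])"
    have xs: "set ?xs \<subseteq> S" using sub[of "Suc j"] j by simp
    have e: "lp ?xs = inv (p (Suc j))" using lp_rev[OF sub[of "Suc j"]] j by (simp add: p_def)
    have neg: "s \<in> desc (p (Suc j)) \<longleftrightarrow> play ?xs (\<lambda>_. 1) s < 0" if "s \<in> S" for s
      using descent_iff_play(1)[OF xs that, of "\<lambda>_. 1"] e len_right_inv[OF that pc[of "Suc j"]] pc[of "Suc j"] that j
      by (simp add: desc_iff)
    note P = play_path[OF path, of "Suc j", unfolded Let_def]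
    have fin: "play ?xs (\<lambda>_. 1) (f j) < 0" using P j by simp
    have "s \<notin> desc (p (Suc j))" if s: "s \<in> S" "s \<noteq> f j" for s
    proof (cases "s \<in> f ` {..<Suc j}")
      case True
      then obtain i where i: "i < Suc j" "s = f i" by auto
      then have "Suc i < Suc j" using s by (cases "i = j") auto
      then have "play ?xs (\<lambda>_. 1) s > 0" using P j i by simp
      then show ?thesis using neg[OF s(1)] by linarith
    next
      case False
      then have "play ?xs (\<lambda>_. 1) s \<ge> 1" using P j s by simp
      then show ?thesis using neg[OF s(1)] by linarith
    qed
    then show ?thesis using neg[OF fS[OF j]] fin fS[OF j] desc_subset by blast
  qed
  have popp: "pop (p (Suc j)) = p j" if j: "j < k" for j
  proof -
    have "len (p (Suc j) \<otimes> f j) < len (p (Suc j))" using desc[OF j] by (auto simp: desc_iff)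
    then have "len (p j) < len (p j \<otimes> f j)"
      using S_cancel_right[OF fS[OF j], of "p j"] pc[of j] j by (simp add: pS[OF j])
    moreover have "f j \<in> para {f j}" using fS[OF j] by (intro para_gen) auto
    ultimately show ?thesis
      using pop_eqI[of "p j" "f j"] pc[of j] desc[OF j] j by (simp add: pS[OF j])
  qed
  have popk: "(pop ^^ j) (p k) = p (k - j)" if "j \<le> k" for j
    using that
  proof (induction j)
    case (Suc j)
    then have "k - j = Suc (k - Suc j)" by simp
    then show ?case using popp[of "k - Suc j"] Suc by simp
  qed simp
  have "p (Suc j) \<noteq> \<one>" if "j < k" for j
    using desc[OF that] by (auto simp: desc_iff)
  then have "(pop ^^ j) (p k) \<noteq> \<one>" if "j < k" for j
    using popk[of j] that by (metis Suc_diff_Suc diff_less less_imp_le less_nat_zero_code not_gr0 diff_Suc_less)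
  then show ?thesis using pc[of k] by blast
qed

text \<open>Balls in a locally finite graph are finite, so some vertex is at distance at least
  \<open>n\<close> from \<open>a\<close>; a shortest walk to it repeats no vertex.\<close>

lemma long_path:
  assumes irr: "coxeter_irreducible S m" and inf: "infinite S"
    and deg: "\<And>v. finite {r. (v, r) \<in> diagram}"
  shows "\<exists>f k. n \<le> k \<and> (\<forall>i<k. (f i, f (Suc i)) \<in> diagram) \<and> inj_on f {..k::nat}"
proof -
  obtain a where a: "a \<in> S" using inf by (metis finite.emptyI ex_in_conv)
  have fin: "finite {r. (a, r) \<in> diagram ^^ i}" for i
  proof (induction i)
    case (Suc i)
    have "{r. (a, r) \<in> diagram ^^ Suc i} = (\<Union>v\<in>{r. (a, r) \<in> diagram ^^ i}. {r. (v, r) \<in> diagram})" by auto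
    then show ?case using Suc deg by simp
  qed simp
  then have "finite (\<Union>i\<in>{..<n}. {r. (a, r) \<in> diagram ^^ i})" by blast
  then obtain b where b: "b \<in> S" "\<And>i. i < n \<Longrightarrow> (a, b) \<notin> diagram ^^ i"
    using inf finite_subset[of S "\<Union>i\<in>{..<n}. {r. (a, r) \<in> diagram ^^ i}"] by blast
  have "(a, b) \<in> diagram\<^sup>*" using irr a b by (auto simp: coxeter_irreducible_def)
  then have ex: "\<exists>i. (a, b) \<in> diagram ^^ i" using rtrancl_power by blast
  define k where "k = (LEAST i. (a, b) \<in> diagram ^^ i)"
  have kk: "(a, b) \<in> diagram ^^ k" unfolding k_def by (rule LeastI_ex[OF ex])
  have least: "k \<le> i" if "(a, b) \<in> diagram ^^ i" for i unfolding k_def using that by (rule Least_le)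
  obtain f where f: "f 0 = a" "f k = b" "\<forall>i<k. (f i, f (Suc i)) \<in> diagram"
    using kk relpow_fun_conv[of a b k diagram] by blast
  have sub: "(f i, f (i + d)) \<in> diagram ^^ d" if "i + d \<le> k" for i d
    using that f(3) by (induction d) auto
  have neq: "f i \<noteq> f j" if "i < j" "j \<le> k" for i j
  proof
    assume e: "f i = f j"
    have "(f 0, f i) \<in> diagram ^^ i" using sub[of 0 i] that by simp
    moreover have "(f i, f k) \<in> diagram ^^ (k - j)" using sub[of j "k - j"] that e by simp
    ultimately have "(a, b) \<in> diagram ^^ (i + (k - j))" using f by (auto simp: relpow_add)
    then show False using least that by fastforce
  qed
  then have "inj_on f {..k}" by (intro linorder_inj_onI') auto
  moreover have "n \<le> k" using b(2) kk not_less by blast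
  ultimately show ?thesis using f(3) by blast
qed

theorem sup_orbit_infinite:
  assumes irr: "coxeter_irreducible S m" and inf: "infinite (carrier W)"
  shows "(SUP w \<in> carrier W. ecard (forward_orbit pop w)) = \<infinity>"
proof -
  have "\<exists>w\<in>carrier W. \<forall>j<n. (pop ^^ j) w \<noteq> \<one>" for n
  proof (cases "\<exists>I. I \<subseteq> S \<and> finite I \<and> infinite (para I)")
    case True
    then show ?thesis using orbit_infinite_para by blast
  next
    case False
    then have fin: "finite (para I)" if "I \<subseteq> S" "finite I" for I using that by blast
    \<comment> \<open>A finite \<open>S\<close> would itself be an admissible \<open>I\<close>, with
      \<open>para S\<close> the whole infinite group.\<close>
    have "infinite S" using fin[of S] inf carrier_para by auto
    then obtain f k where "n \<le> k" "\<forall>i<k. (f i, f (Suc i)) \<in> diagram" "inj_on f {..k::nat}"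
      using long_path[OF irr, of n] degree_le_3[OF fin] by blast
    then show ?thesis using orbit_path[of k f] by (meson order_less_le_trans)
  qed
  then have "enat n \<le> (SUP w \<in> carrier W. ecard (forward_orbit pop w))" for n
    using orbit_ge by (meson SUP_upper2 Suc_n_not_le_n enat_ord_simps(1) nle_le order_trans)
  then show ?thesis
    by (metis enat_ord_simps(1) not_enat_eq Suc_n_not_le_n)
qed

end

theorem theorem1p3:
  fixes W :: "('a, 'b) monoid_scheme"
    and S :: "'a set"
    and m :: "'a \<Rightarrow> 'a \<Rightarrow> enat"
    and h :: enat
  assumes "coxeter_system W S m"
    and "coxeter_irreducible S m"
    and "is_coxeter_number W S h"
  shows "(SUP w \<in> carrier W. ecard (forward_orbit (coxeter_pop W S) w)) = h"
proof -
  interpret group W using assms(1) by (simp add: coxeter_system_def)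
  interpret coxeter W S m using assms(1) by unfold_locales
  show ?thesis
  proof (cases "finite (carrier W)")
    case True
    then show ?thesis
      using assms(3) sup_orbit_finite[OF assms(2) True] by (auto simp: is_coxeter_number_def)
  next
    case False
    then show ?thesis
      using assms(3) sup_orbit_infinite[OF assms(2) False] by (simp add: is_coxeter_number_def)
  qed
qed

end
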